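(* Let $f\colon\Gamma\to\Delta$ be a regular covering of profinite graphs, and let $G=\operatorname{Aut}(\Gamma,f)$ be its group of covering transformations. Then $G$ is a profinite group whose action on $\Gamma$ is continuous, residually free, and simply transitive on the fiber $f^{-1}(b)$, for any vertex $b$ of $\Delta$.
   Context: A graph $\Gamma$ is a set that is the disjoint union of a set $V(\Gamma)$ of vertices and a set $E(\Gamma)$ of edges, with maps $s,t\colon E(\Gamma)\to V(\Gamma)$ and an involution $e\mapsto\overline e$ of $E(\Gamma)$ such that $\overline e\ne e$, $s(\overline e)=t(e)$, $t(\overline e)=s(e)$. A map of graphs sends vertices to vertices and edges to edges and commutes with $s$, $t$ and $e\mapsto\overline e$. It is locally bijective if for every vertex $v$ it restricts to a bijection from $\{e\mid s(e)=v\}$ onto $\{e'\mid s(e')=f(v)\}$. A graph is path connected if it is nonempty and any two vertices are joined by a finite edge path. A regular covering of finite path connected graphs is a locally bijective map $q\colon X\to Y$ of such graphs with $q_*\pi_1(X,x)$ normal in $\pi_1(Y,q(x))$ for a vertex $x$ (equivalently, the group of automorphisms of $X$ over $Y$ is transitive on each vertex fiber). An equivalence relation $R$ on a graph $\Gamma$ is compatible if no vertex is equivalent to an edge, if $(e_1,e_2)\in R$ for edges implies $(s(e_1),s(e_2)),(t(e_1),t(e_2)),(\overline{e_1},\overline{e_2})\in R$, and $(e,\overline e)\notin R$ for all edges $e$; thus the set $\Gamma/R$ of classes $R[x]$ is a graph. A cofinite graph is a graph with a Hausdorff uniformity in which every entourage contains a compatible cofinite entourage, i.e. an entourage that is a compatible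 equivalence relation with finitely many classes. A profinite graph is a compact cofinite graph (equivalently, an inverse limit of finite discrete graphs). A fundamental system of entourages is a set of entourages such that every entourage contains one of them. An inverse system of maps $(f_i\colon\Gamma_i\to\Delta_i,\phi_{ij},\psi_{ij})$ over a directed set $I$ consists of continuous maps of graphs $f_i$, and, for $j\ge i$, continuous maps of graphs $\phi_{ij}\colon\Gamma_j\to\Gamma_i$, $\psi_{ij}\colon\Delta_j\to\Delta_i$ forming inverse systems, with $f_i\phi_{ij}=\psi_{ij}f_j$. Its inverse limit is the induced continuous map $f\colon\varprojlim\Gamma_i\to\varprojlim\Delta_i$. A map of profinite graphs is a regular covering if it is the inverse limit of an inverse system in which each $f_i$ is a regular covering of path connected finite discrete graphs. $\operatorname{Aut}(\Gamma,f)$ is the group of continuous maps of graphs $h\colon\Gamma\to\Gamma$ with continuous inverse and $fh=f$. It carries the uniformity (group topology) induced by its action: a base of neighbourhoods of $1$ is given by the finite-index normal subgroups $N_R=\{g\in G\mid (gx,x)\in R\ \forall x\in\Gamma\}$, where $R$ runs over the $G$-invariant compatible cofinite entourages of $\Gamma$ (those with $(g\times g)[R]=R$ for all $g$). An action of a group $G$ on a profinite graph $\Gamma$ is residually free if there is a fundamental system of entourages of $\Gamma$ consisting of $G$-invariant compatible cofinite entourages $R$ such that the induced faithful action of $G/N_R$ on $\Gamma/R$ is free, where $N_R$ is the kernel of the action $g\cdot R[x]=R[gx]$ of $G$ on $\Gamma/R$. The action is continuous if $G\times\Gamma\to\Gamma$ is continuous. *)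

theory Defs
  imports "HOL-Analysis.Analysis" "HOL-Algebra.Group_Action"
begin

text \<open>
  Vertices and edges are elements of one underlying type, since a uniformity on a graph is a
  uniformity on the union of its vertices and edges.  The values of \<open>src\<close>, \<open>tgt\<close> and \<open>einv\<close>
  matter only on edges.
\<close>

record 'a pre_graph =
  verts :: "'a set"
  edges :: "'a set"
  src :: "'a \<Rightarrow> 'a"
  tgt :: "'a \<Rightarrow> 'a"
  einv :: "'a \<Rightarrow> 'a"

definition points :: "'a pre_graph \<Rightarrow> 'a set" where
  "points \<Gamma> = verts \<Gamma> \<union> edges \<Gamma>"

definition is_graph :: "'a pre_graph \<Rightarrow> bool" where
  "is_graph \<Gamma> \<longleftrightarrow>
     verts \<Gamma> \<inter> edges \<Gamma> = {} \<and>
     (\<forall>e\<in>edges \<Gamma>. src \<Gamma> e \<in> verts \<Gamma> \<and> tgt \<Gamma> e \<in> verts \<Gamma> \<and>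
        einv \<Gamma> e \<in> edges \<Gamma> \<and> einv \<Gamma> (einv \<Gamma> e) = e \<and> einv \<Gamma> e \<noteq> e \<and>
        src \<Gamma> (einv \<Gamma> e) = tgt \<Gamma> e \<and> tgt \<Gamma> (einv \<Gamma> e) = src \<Gamma> e)"

definition graph_map :: "'a pre_graph \<Rightarrow> 'b pre_graph \<Rightarrow> ('a \<Rightarrow> 'b) \<Rightarrow> bool" where
  "graph_map \<Gamma> \<Delta> f \<longleftrightarrow>
     f ` verts \<Gamma> \<subseteq> verts \<Delta> \<and> f ` edges \<Gamma> \<subseteq> edges \<Delta> \<and>
     (\<forall>e\<in>edges \<Gamma>. f (src \<Gamma> e) = src \<Delta> (f e) \<and> f (tgt \<Gamma> e) = tgt \<Delta> (f e) \<and>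
        f (einv \<Gamma> e) = einv \<Delta> (f e))"

definition locally_bijective :: "'a pre_graph \<Rightarrow> 'b pre_graph \<Rightarrow> ('a \<Rightarrow> 'b) \<Rightarrow> bool" where
  "locally_bijective X Y q \<longleftrightarrow>
     (\<forall>v\<in>verts X. bij_betw q {e \<in> edges X. src X e = v} {e' \<in> edges Y. src Y e' = q v})"

fun edge_path :: "'a pre_graph \<Rightarrow> 'a \<Rightarrow> 'a list \<Rightarrow> 'a \<Rightarrow> bool" where
  "edge_path \<Gamma> u [] v \<longleftrightarrow> u \<in> verts \<Gamma> \<and> u = v"
| "edge_path \<Gamma> u (e # p) v \<longleftrightarrow> e \<in> edges \<Gamma> \<and> src \<Gamma> e = u \<and> edge_path \<Gamma> (tgt \<Gamma> e) p v"

definition path_connected_graph :: "'a pre_graph \<Rightarrow> bool" where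
  "path_connected_graph \<Gamma> \<longleftrightarrow>
     points \<Gamma> \<noteq> {} \<and> (\<forall>u\<in>verts \<Gamma>. \<forall>v\<in>verts \<Gamma>. \<exists>p. edge_path \<Gamma> u p v)"

definition loops :: "'a pre_graph \<Rightarrow> 'a \<Rightarrow> 'a list set" where
  "loops \<Gamma> x = {p. edge_path \<Gamma> x p x}"

text \<open>Homotopy of loops is generated by inserting and deleting backtracks \<open>[e, einv \<Gamma> e]\<close>.\<close>

definition backtrack :: "'a pre_graph \<Rightarrow> 'a \<Rightarrow> ('a list \<times> 'a list) set" where
  "backtrack \<Gamma> x =
     {(p, q). p \<in> loops \<Gamma> x \<and> q \<in> loops \<Gamma> x \<and>
        (\<exists>a e b. e \<in> edges \<Gamma> \<and> p = a @ b \<and> q = a @ [e, einv \<Gamma> e] @ b)}"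

definition loop_homotopy :: "'a pre_graph \<Rightarrow> 'a \<Rightarrow> ('a list \<times> 'a list) set" where
  "loop_homotopy \<Gamma> x = (backtrack \<Gamma> x \<union> (backtrack \<Gamma> x)\<inverse>)\<^sup>* \<inter> loops \<Gamma> x \<times> loops \<Gamma> x"

definition fundamental_group :: "'a pre_graph \<Rightarrow> 'a \<Rightarrow> 'a list set monoid" where
  "fundamental_group \<Gamma> x =
     \<lparr>carrier = loops \<Gamma> x // loop_homotopy \<Gamma> x,
      mult = (\<lambda>A B. \<Union>p\<in>A. \<Union>q\<in>B. loop_homotopy \<Gamma> x `` {p @ q}),
      one = loop_homotopy \<Gamma> x `` {[]}\<rparr>"

lemma edge_path_start: "is_graph \<Gamma> \<Longrightarrow> edge_path \<Gamma> u p v \<Longrightarrow> u \<in> verts \<Gamma>"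
  by (cases p) (auto simp: is_graph_def)

lemma edge_path_append:
  assumes "is_graph \<Gamma>"
  shows "edge_path \<Gamma> u (p @ q) w \<longleftrightarrow> (\<exists>v. edge_path \<Gamma> u p v \<and> edge_path \<Gamma> v q w)"
  by (induction p arbitrary: u) (auto dest: edge_path_start[OF assms])

lemma edge_path_rev:
  assumes "is_graph \<Gamma>" "edge_path \<Gamma> u p v"
  shows "edge_path \<Gamma> v (rev (map (einv \<Gamma>) p)) u"
  using assms(2)
proof (induction p arbitrary: u)
  case Nil
  then show ?case by auto
next
  case (Cons e p)
  then show ?case using assms(1) by (auto simp: edge_path_append is_graph_def)
qed

lemma edge_path_edges: "edge_path \<Gamma> u p v \<Longrightarrow> set p \<subseteq> edges \<Gamma>"
  by (induction p arbitrary: u) auto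

lemma equiv_loop_homotopy: "equiv (loops \<Gamma> x) (loop_homotopy \<Gamma> x)"
proof (rule equivI)
  show "loop_homotopy \<Gamma> x \<subseteq> loops \<Gamma> x \<times> loops \<Gamma> x"
    by (auto simp: loop_homotopy_def)
  show "refl_on (loops \<Gamma> x) (loop_homotopy \<Gamma> x)"
    by (auto simp: loop_homotopy_def refl_on_def)
  have "sym ((backtrack \<Gamma> x \<union> (backtrack \<Gamma> x)\<inverse>)\<^sup>*)"
    by (intro sym_rtrancl) (auto simp: sym_def)
  then show "sym (loop_homotopy \<Gamma> x)"
    by (auto simp: loop_homotopy_def sym_def)
  show "trans (loop_homotopy \<Gamma> x)"
    by (auto simp: loop_homotopy_def trans_def intro: rtrancl_trans)
qed

lemma loops_append: "is_graph \<Gamma> \<Longrightarrow> p \<in> loops \<Gamma> x \<Longrightarrow> q \<in> loops \<Gamma> x \<Longrightarrow> p @ q \<in> loops \<Gamma> x"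
  by (auto simp: loops_def edge_path_append)

lemma backtrack_append:
  assumes "is_graph \<Gamma>" "q \<in> loops \<Gamma> x" "(p, p') \<in> backtrack \<Gamma> x"
  shows "(p @ q, p' @ q) \<in> backtrack \<Gamma> x" "(q @ p, q @ p') \<in> backtrack \<Gamma> x"
proof -
  obtain a e b where e: "e \<in> edges \<Gamma>" and p: "p = a @ b" and p': "p' = a @ [e, einv \<Gamma> e] @ b"
    and l: "p \<in> loops \<Gamma> x" "p' \<in> loops \<Gamma> x"
    using assms(3) by (auto simp: backtrack_def)
  have r: "p @ q = a @ (b @ q)" "p' @ q = a @ [e, einv \<Gamma> e] @ (b @ q)"
    and s: "q @ p = (q @ a) @ b" "q @ p' = (q @ a) @ [e, einv \<Gamma> e] @ b"
    by (simp_all only: p p' append_assoc)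
  have "\<exists>a e b. e \<in> edges \<Gamma> \<and> p @ q = a @ b \<and> p' @ q = a @ [e, einv \<Gamma> e] @ b"
    by (rule exI[of _ a], rule exI[of _ e], rule exI[of _ "b @ q"]) (rule conjI[OF e conjI[OF r]])
  then show "(p @ q, p' @ q) \<in> backtrack \<Gamma> x"
    using loops_append[OF assms(1) l(1) assms(2)] loops_append[OF assms(1) l(2) assms(2)]
    by (simp only: backtrack_def mem_Collect_eq prod.case simp_thms)
  have "\<exists>a e b. e \<in> edges \<Gamma> \<and> q @ p = a @ b \<and> q @ p' = a @ [e, einv \<Gamma> e] @ b"
    by (rule exI[of _ "q @ a"], rule exI[of _ e], rule exI[of _ b]) (rule conjI[OF e conjI[OF s]])
  then show "(q @ p, q @ p') \<in> backtrack \<Gamma> x"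
    using loops_append[OF assms(1) assms(2) l(1)] loops_append[OF assms(1) assms(2) l(2)]
    by (simp only: backtrack_def mem_Collect_eq prod.case simp_thms)
qed

lemma loop_homotopy_append:
  assumes g: "is_graph \<Gamma>" and p: "(p, p') \<in> loop_homotopy \<Gamma> x" and q: "(q, q') \<in> loop_homotopy \<Gamma> x"
  shows "(p @ q, p' @ q') \<in> loop_homotopy \<Gamma> x"
proof -
  let ?S = "backtrack \<Gamma> x \<union> (backtrack \<Gamma> x)\<inverse>"
  have l: "p \<in> loops \<Gamma> x" "p' \<in> loops \<Gamma> x" "q \<in> loops \<Gamma> x" "q' \<in> loops \<Gamma> x"
    and pS: "(p, p') \<in> ?S\<^sup>*" and qS: "(q, q') \<in> ?S\<^sup>*"
    using p q by (auto simp: loop_homotopy_def)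
  have "(p @ q, p' @ q) \<in> ?S\<^sup>*" using pS
  proof induction
    case (step y z)
    then have "(y @ q, z @ q) \<in> ?S" using backtrack_append(1)[OF g l(3)] by blast
    then show ?case using step.IH by (rule rtrancl_into_rtrancl[rotated])
  qed simp
  moreover have "(p' @ q, p' @ q') \<in> ?S\<^sup>*" using qS
  proof induction
    case (step y z)
    then have "(p' @ y, p' @ z) \<in> ?S" using backtrack_append(2)[OF g l(2)] by blast
    then show ?case using step.IH by (rule rtrancl_into_rtrancl[rotated])
  qed simp
  ultimately show ?thesis
    using l loops_append[OF g] by (auto simp: loop_homotopy_def intro: rtrancl_trans)
qed

lemma path_rev_null_homotopic:
  assumes g: "is_graph \<Gamma>"
  shows "edge_path \<Gamma> x p y \<Longrightarrow> (p @ rev (map (einv \<Gamma>) p), []) \<in> loop_homotopy \<Gamma> x"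
proof (induction p arbitrary: y rule: rev_induct)
  case Nil
  then show ?case by (auto simp: loop_homotopy_def loops_def)
next
  case (snoc e p)
  let ?S = "backtrack \<Gamma> x \<union> (backtrack \<Gamma> x)\<inverse>"
  have e: "e \<in> edges \<Gamma>" and p: "edge_path \<Gamma> x p (src \<Gamma> e)"
    using snoc.prems by (auto simp: edge_path_append[OF g])
  let ?r = "rev (map (einv \<Gamma>) p)"
  have 1: "(p @ ?r, []) \<in> loop_homotopy \<Gamma> x" using snoc.IH[OF p] .
  have "(p @ [e]) @ rev (map (einv \<Gamma>) (p @ [e])) \<in> loops \<Gamma> x"
    using snoc.prems edge_path_rev[OF g snoc.prems] unfolding loops_def edge_path_append[OF g] mem_Collect_eq
    by blast
  then have 2: "p @ [e, einv \<Gamma> e] @ ?r \<in> loops \<Gamma> x" by simp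
  have "(p @ ?r, p @ [e, einv \<Gamma> e] @ ?r) \<in> backtrack \<Gamma> x"
    unfolding backtrack_def using 1 2 e by (auto simp: loop_homotopy_def)
  then have "(p @ [e, einv \<Gamma> e] @ ?r, p @ ?r) \<in> ?S\<^sup>*" by blast
  then have "(p @ [e, einv \<Gamma> e] @ ?r, []) \<in> loop_homotopy \<Gamma> x"
    using 1 2 by (auto simp: loop_homotopy_def intro: rtrancl_trans)
  then show ?case by simp
qed

lemma group_fundamental_group:
  assumes g: "is_graph \<Gamma>" and x: "x \<in> verts \<Gamma>"
  shows "group (fundamental_group \<Gamma> x)"
proof -
  let ?H = "loop_homotopy \<Gamma> x" and ?P = "fundamental_group \<Gamma> x"
  have eq: "equiv (loops \<Gamma> x) ?H" by (rule equiv_loop_homotopy)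
  have mult: "?H `` {p} \<otimes>\<^bsub>?P\<^esub> ?H `` {q} = ?H `` {p @ q}"
    if "p \<in> loops \<Gamma> x" "q \<in> loops \<Gamma> x" for p q
  proof -
    have *: "?H `` {p' @ q'} = ?H `` {p @ q}" if "p' \<in> ?H `` {p}" "q' \<in> ?H `` {q}" for p' q'
      using that loop_homotopy_append[OF g, of p p' x q q'] equiv_class_eq[OF eq] by blast
    have "p \<in> ?H `` {p}" "q \<in> ?H `` {q}"
      using equiv_class_self[OF eq] that by auto
    with * have "(\<Union>p'\<in>?H `` {p}. \<Union>q'\<in>?H `` {q}. ?H `` {p' @ q'}) = ?H `` {p @ q}"
      by blast
    then show ?thesis by (simp only: fundamental_group_def monoid.simps)
  qed
  have nil: "[] \<in> loops \<Gamma> x" using x by (simp add: loops_def)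
  have car: "A \<in> carrier ?P \<longleftrightarrow> (\<exists>p\<in>loops \<Gamma> x. A = ?H `` {p})" for A
    by (auto simp: fundamental_group_def quotient_def)
  have one: "\<one>\<^bsub>?P\<^esub> = ?H `` {[]}" by (simp add: fundamental_group_def)
  show ?thesis
  proof (rule groupI)
    fix A B C assume "A \<in> carrier ?P" "B \<in> carrier ?P" "C \<in> carrier ?P"
    then show "A \<otimes>\<^bsub>?P\<^esub> B \<otimes>\<^bsub>?P\<^esub> C = A \<otimes>\<^bsub>?P\<^esub> (B \<otimes>\<^bsub>?P\<^esub> C)"
      by (auto simp: car mult loops_append[OF g])
  next
    fix A assume "A \<in> carrier ?P"
    then obtain p where p: "p \<in> loops \<Gamma> x" "A = ?H `` {p}" by (auto simp: car)
    let ?r = "rev (map (einv \<Gamma>) p)"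
    have r: "?r \<in> loops \<Gamma> x" using p edge_path_rev[OF g] by (auto simp: loops_def)
    have "map (einv \<Gamma>) (map (einv \<Gamma>) p) = p"
      using p edge_path_edges[of \<Gamma> x p x] g by (auto simp: loops_def is_graph_def intro!: map_idI)
    then have "(?r @ p, []) \<in> ?H"
      using path_rev_null_homotopic[OF g, of x ?r x] r by (simp add: loops_def rev_map)
    then have "?H `` {?r @ p} = ?H `` {[]}" by (rule equiv_class_eq[OF eq])
    then show "\<exists>B\<in>carrier ?P. B \<otimes>\<^bsub>?P\<^esub> A = \<one>\<^bsub>?P\<^esub>"
      using r p by (intro bexI[of _ "?H `` {?r}"]) (auto simp: mult one car)
  qed (auto simp: car mult one nil loops_append[OF g])
qed

definition induced_hom :: "'b pre_graph \<Rightarrow> ('a \<Rightarrow> 'b) \<Rightarrow> 'a \<Rightarrow> 'a list set \<Rightarrow> 'b list set" where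
  "induced_hom Y q x A = (\<Union>p\<in>A. loop_homotopy Y (q x) `` {map q p})"

definition finite_regular_covering :: "'a pre_graph \<Rightarrow> 'b pre_graph \<Rightarrow> ('a \<Rightarrow> 'b) \<Rightarrow> bool" where
  "finite_regular_covering X Y q \<longleftrightarrow>
     is_graph X \<and> finite (points X) \<and> path_connected_graph X \<and>
     is_graph Y \<and> finite (points Y) \<and> path_connected_graph Y \<and>
     graph_map X Y q \<and> locally_bijective X Y q \<and>
     (\<exists>x\<in>verts X. induced_hom Y q x ` carrier (fundamental_group X x)
                    \<lhd> fundamental_group Y (q x))"

definition entourage :: "('a::uniform_space \<times> 'a) set \<Rightarrow> bool" where
  "entourage R \<longleftrightarrow> eventually (\<lambda>p. p \<in> R) uniformity"

definition compatible :: "'a pre_graph \<Rightarrow> ('a \<times> 'a) set \<Rightarrow> bool" where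
  "compatible \<Gamma> R \<longleftrightarrow>
     equiv (points \<Gamma>) R \<and>
     (\<forall>v\<in>verts \<Gamma>. \<forall>e\<in>edges \<Gamma>. (v, e) \<notin> R) \<and>
     (\<forall>e\<^sub>1\<in>edges \<Gamma>. \<forall>e\<^sub>2\<in>edges \<Gamma>. (e\<^sub>1, e\<^sub>2) \<in> R \<longrightarrow>
        (src \<Gamma> e\<^sub>1, src \<Gamma> e\<^sub>2) \<in> R \<and> (tgt \<Gamma> e\<^sub>1, tgt \<Gamma> e\<^sub>2) \<in> R \<and>
        (einv \<Gamma> e\<^sub>1, einv \<Gamma> e\<^sub>2) \<in> R) \<and>
     (\<forall>e\<in>edges \<Gamma>. (e, einv \<Gamma> e) \<notin> R)"

definition compatible_cofinite_entourage :: "'a::uniform_space pre_graph \<Rightarrow> ('a \<times> 'a) set \<Rightarrow> bool" where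
  "compatible_cofinite_entourage \<Gamma> R \<longleftrightarrow>
     entourage R \<and> compatible \<Gamma> R \<and> finite (points \<Gamma> // R)"

text \<open>The underlying Hausdorff uniform space of a cofinite graph is its whole type.\<close>

definition cofinite_graph :: "'a::{t2_space,uniform_space} pre_graph \<Rightarrow> bool" where
  "cofinite_graph \<Gamma> \<longleftrightarrow>
     is_graph \<Gamma> \<and> points \<Gamma> = UNIV \<and>
     (\<forall>S. entourage S \<longrightarrow> (\<exists>R\<subseteq>S. compatible_cofinite_entourage \<Gamma> R))"

definition profinite_graph :: "'a::{t2_space,uniform_space} pre_graph \<Rightarrow> bool" where
  "profinite_graph \<Gamma> \<longleftrightarrow> cofinite_graph \<Gamma> \<and> compact (UNIV :: 'a set)"

definition fundamental_system :: "('a::uniform_space \<times> 'a) set set \<Rightarrow> bool" where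
  "fundamental_system \<F> \<longleftrightarrow>
     (\<forall>R\<in>\<F>. entourage R) \<and> (\<forall>S. entourage S \<longrightarrow> (\<exists>R\<in>\<F>. R \<subseteq> S))"

definition directed_index :: "'i set \<Rightarrow> ('i \<Rightarrow> 'i \<Rightarrow> bool) \<Rightarrow> bool" where
  "directed_index I below \<longleftrightarrow>
     I \<noteq> {} \<and> (\<forall>i\<in>I. below i i) \<and>
     (\<forall>i\<in>I. \<forall>j\<in>I. \<forall>k\<in>I. below i j \<longrightarrow> below j k \<longrightarrow> below i k) \<and>
     (\<forall>i\<in>I. \<forall>j\<in>I. \<exists>k\<in>I. below i k \<and> below j k)"

text \<open>
  The systems below consist of discrete graphs, so continuity of their maps is automatic.
  The transition map \<open>\<phi> i j\<close> goes from \<open>X j\<close> to \<open>X i\<close>.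
\<close>

definition graph_inverse_system ::
    "'i set \<Rightarrow> ('i \<Rightarrow> 'i \<Rightarrow> bool) \<Rightarrow> ('i \<Rightarrow> 'c pre_graph) \<Rightarrow> ('i \<Rightarrow> 'i \<Rightarrow> 'c \<Rightarrow> 'c) \<Rightarrow> bool" where
  "graph_inverse_system I below X \<phi> \<longleftrightarrow>
     (\<forall>i\<in>I. is_graph (X i)) \<and>
     (\<forall>i\<in>I. \<forall>j\<in>I. below i j \<longrightarrow> graph_map (X j) (X i) (\<phi> i j)) \<and>
     (\<forall>i\<in>I. \<forall>x\<in>points (X i). \<phi> i i x = x) \<and>
     (\<forall>i\<in>I. \<forall>j\<in>I. \<forall>k\<in>I. below i j \<longrightarrow> below j k \<longrightarrow>
        (\<forall>x\<in>points (X k). \<phi> i j (\<phi> j k x) = \<phi> i k x))"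

definition limit_graph ::
    "'i set \<Rightarrow> ('i \<Rightarrow> 'i \<Rightarrow> bool) \<Rightarrow> ('i \<Rightarrow> 'c pre_graph) \<Rightarrow> ('i \<Rightarrow> 'i \<Rightarrow> 'c \<Rightarrow> 'c)
      \<Rightarrow> ('i \<Rightarrow> 'c) pre_graph" where
  "limit_graph I below X \<phi> =
     \<lparr>verts = {x \<in> (\<Pi>\<^sub>E i\<in>I. verts (X i)). \<forall>i\<in>I. \<forall>j\<in>I. below i j \<longrightarrow> \<phi> i j (x j) = x i},
      edges = {x \<in> (\<Pi>\<^sub>E i\<in>I. edges (X i)). \<forall>i\<in>I. \<forall>j\<in>I. below i j \<longrightarrow> \<phi> i j (x j) = x i},
      src = (\<lambda>x. \<lambda>i\<in>I. src (X i) (x i)),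
      tgt = (\<lambda>x. \<lambda>i\<in>I. tgt (X i) (x i)),
      einv = (\<lambda>x. \<lambda>i\<in>I. einv (X i) (x i))\<rparr>"

definition limit_topology ::
    "'i set \<Rightarrow> ('i \<Rightarrow> 'i \<Rightarrow> bool) \<Rightarrow> ('i \<Rightarrow> 'c pre_graph) \<Rightarrow> ('i \<Rightarrow> 'i \<Rightarrow> 'c \<Rightarrow> 'c)
      \<Rightarrow> ('i \<Rightarrow> 'c) topology" where
  "limit_topology I below X \<phi> =
     subtopology (product_topology (\<lambda>i. discrete_topology (points (X i))) I)
       (points (limit_graph I below X \<phi>))"

text \<open>
  A presentation of a profinite graph as a limit.  Only the topology has to be matched, because a
  compact Hausdorff space carries exactly one uniformity.
\<close>

definition limit_iso ::
    "'i set \<Rightarrow> ('i \<Rightarrow> 'i \<Rightarrow> bool) \<Rightarrow> ('i \<Rightarrow> 'c pre_graph) \<Rightarrow> ('i \<Rightarrow> 'i \<Rightarrow> 'c \<Rightarrow> 'c)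
      \<Rightarrow> 'a::topological_space pre_graph \<Rightarrow> ('a \<Rightarrow> 'i \<Rightarrow> 'c) \<Rightarrow> bool" where
  "limit_iso I below X \<phi> \<Gamma> \<alpha> \<longleftrightarrow>
     graph_map \<Gamma> (limit_graph I below X \<phi>) \<alpha> \<and>
     homeomorphic_map euclidean (limit_topology I below X \<phi>) \<alpha>"

text \<open>
  HOL cannot quantify over the types of the index set and of the finite graphs inside a
  definition, so they are a parameter of the notion.
\<close>

definition regular_covering ::
    "('i \<times> 'c \<times> 'd) itself \<Rightarrow> 'a::{t2_space,uniform_space} pre_graph
      \<Rightarrow> 'b::{t2_space,uniform_space} pre_graph \<Rightarrow> ('a \<Rightarrow> 'b) \<Rightarrow> bool" where
  "regular_covering _ \<Gamma> \<Delta> f \<longleftrightarrow>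
     profinite_graph \<Gamma> \<and> profinite_graph \<Delta> \<and> graph_map \<Gamma> \<Delta> f \<and> continuous_on UNIV f \<and>
     (\<exists>(I :: 'i set) below (X :: 'i \<Rightarrow> 'c pre_graph) \<phi> (Y :: 'i \<Rightarrow> 'd pre_graph) \<psi> q \<alpha> \<beta>.
        directed_index I below \<and>
        graph_inverse_system I below X \<phi> \<and> graph_inverse_system I below Y \<psi> \<and>
        (\<forall>i\<in>I. finite_regular_covering (X i) (Y i) (q i)) \<and>
        (\<forall>i\<in>I. \<forall>j\<in>I. below i j \<longrightarrow> (\<forall>x\<in>points (X j). q i (\<phi> i j x) = \<psi> i j (q j x))) \<and>
        limit_iso I below X \<phi> \<Gamma> \<alpha> \<and> limit_iso I below Y \<psi> \<Delta> \<beta> \<and>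
        (\<forall>x\<in>points \<Gamma>. \<beta> (f x) = (\<lambda>i\<in>I. q i (\<alpha> x i))))"

definition graph_action :: "('g, 'm) monoid_scheme \<Rightarrow> 'a pre_graph \<Rightarrow> ('g \<Rightarrow> 'a \<Rightarrow> 'a) \<Rightarrow> bool" where
  "graph_action G \<Gamma> act \<longleftrightarrow>
     group_action G (points \<Gamma>) act \<and> (\<forall>g\<in>carrier G. graph_map \<Gamma> \<Gamma> (act g))"

definition invariant_entourage ::
    "('g, 'm) monoid_scheme \<Rightarrow> 'a::uniform_space pre_graph \<Rightarrow> ('g \<Rightarrow> 'a \<Rightarrow> 'a) \<Rightarrow> ('a \<times> 'a) set \<Rightarrow> bool" where
  "invariant_entourage G \<Gamma> act R \<longleftrightarrow>
     compatible_cofinite_entourage \<Gamma> R \<and>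
     (\<forall>g\<in>carrier G. map_prod (act g) (act g) ` R = R)"

definition action_kernel ::
    "('g, 'm) monoid_scheme \<Rightarrow> 'a pre_graph \<Rightarrow> ('g \<Rightarrow> 'a \<Rightarrow> 'a) \<Rightarrow> ('a \<times> 'a) set \<Rightarrow> 'g set" where
  "action_kernel G \<Gamma> act R = {g \<in> carrier G. \<forall>x\<in>points \<Gamma>. (act g x, x) \<in> R}"

text \<open>
  The group topology in which the kernels \<open>action_kernel G \<Gamma> act R\<close> form a base of neighbourhoods
  of the identity.
\<close>

definition action_topology ::
    "('g, 'm) monoid_scheme \<Rightarrow> 'a::uniform_space pre_graph \<Rightarrow> ('g \<Rightarrow> 'a \<Rightarrow> 'a) \<Rightarrow> 'g topology" where
  "action_topology G \<Gamma> act = topology (\<lambda>U. U \<subseteq> carrier G \<and>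
     (\<forall>g\<in>U. \<exists>R. invariant_entourage G \<Gamma> act R \<and> g <#\<^bsub>G\<^esub> action_kernel G \<Gamma> act R \<subseteq> U))"

lemma invariant_entourage_Int:
  assumes "graph_action G \<Gamma> act" "invariant_entourage G \<Gamma> act R" "invariant_entourage G \<Gamma> act S"
  shows "invariant_entourage G \<Gamma> act (R \<inter> S)"
proof -
  interpret group_action G "points \<Gamma>" act using assms(1) by (simp add: graph_action_def)
  have c: "compatible_cofinite_entourage \<Gamma> R" "compatible_cofinite_entourage \<Gamma> S"
    using assms by (auto simp: invariant_entourage_def)
  have eR: "equiv (points \<Gamma>) R" and eS: "equiv (points \<Gamma>) S"
    using c by (auto simp: compatible_cofinite_entourage_def compatible_def)
  have "points \<Gamma> // (R \<inter> S) \<subseteq> (\<lambda>(A, B). A \<inter> B) ` ((points \<Gamma> // R) \<times> (points \<Gamma> // S))"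
  proof
    fix C assume "C \<in> points \<Gamma> // (R \<inter> S)"
    then obtain x where "x \<in> points \<Gamma>" "C = R `` {x} \<inter> S `` {x}"
      by (auto simp: quotient_def)
    then show "C \<in> (\<lambda>(A, B). A \<inter> B) ` ((points \<Gamma> // R) \<times> (points \<Gamma> // S))"
      by (auto simp: quotient_def)
  qed
  then have "finite (points \<Gamma> // (R \<inter> S))"
    using c by (auto simp: compatible_cofinite_entourage_def intro: finite_subset)
  moreover have "equiv (points \<Gamma>) (R \<inter> S)"
    using eR eS unfolding equiv_def by (auto intro: sym_Int trans_Int simp: refl_on_def)
  moreover have "entourage (R \<inter> S)"
    using c by (auto simp: compatible_cofinite_entourage_def entourage_def eventually_conj_iff)
  ultimately have cc: "compatible_cofinite_entourage \<Gamma> (R \<inter> S)"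
    using c unfolding compatible_cofinite_entourage_def compatible_def by blast
  have "map_prod (act g) (act g) ` (R \<inter> S) = R \<inter> S" if "g \<in> carrier G" for g
  proof -
    have "inj_on (map_prod (act g) (act g)) (points \<Gamma> \<times> points \<Gamma>)"
      using inj_prop[OF that] inj_prop[OF that] by (rule map_prod_inj_on)
    moreover have "R \<subseteq> points \<Gamma> \<times> points \<Gamma>" "S \<subseteq> points \<Gamma> \<times> points \<Gamma>"
      using eR eS by (auto simp: equiv_def)
    ultimately show ?thesis
      using inj_on_image_Int[of "map_prod (act g) (act g)" "points \<Gamma> \<times> points \<Gamma>" R S] assms(2,3) that
      by (simp add: invariant_entourage_def)
  qed
  with cc show ?thesis by (simp add: invariant_entourage_def)
qed

lemma openin_action_topology:
  assumes "graph_action G \<Gamma> act"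
  shows "openin (action_topology G \<Gamma> act) U \<longleftrightarrow> U \<subseteq> carrier G \<and>
     (\<forall>g\<in>U. \<exists>R. invariant_entourage G \<Gamma> act R \<and> g <#\<^bsub>G\<^esub> action_kernel G \<Gamma> act R \<subseteq> U)"
proof -
  let ?P = "\<lambda>U. U \<subseteq> carrier G \<and>
     (\<forall>g\<in>U. \<exists>R. invariant_entourage G \<Gamma> act R \<and> g <#\<^bsub>G\<^esub> action_kernel G \<Gamma> act R \<subseteq> U)"
  have "istopology ?P"
    unfolding istopology_def
  proof (intro conjI allI impI ballI)
    fix U V assume "?P U" "?P V"
    then show "U \<inter> V \<subseteq> carrier G" by blast
  next
    fix U V g assume U: "?P U" and V: "?P V" and g: "g \<in> U \<inter> V"
    obtain R S where R: "invariant_entourage G \<Gamma> act R" "g <#\<^bsub>G\<^esub> action_kernel G \<Gamma> act R \<subseteq> U"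
      and S: "invariant_entourage G \<Gamma> act S" "g <#\<^bsub>G\<^esub> action_kernel G \<Gamma> act S \<subseteq> V"
      using U V g by blast
    have "g <#\<^bsub>G\<^esub> action_kernel G \<Gamma> act (R \<inter> S) \<subseteq> U \<inter> V"
      using R(2) S(2) unfolding l_coset_def action_kernel_def by fast
    then show "\<exists>T. invariant_entourage G \<Gamma> act T \<and> g <#\<^bsub>G\<^esub> action_kernel G \<Gamma> act T \<subseteq> U \<inter> V"
      using invariant_entourage_Int[OF assms R(1) S(1)] by blast
  next
    fix K assume "\<forall>U\<in>K. ?P U"
    then show "\<Union>K \<subseteq> carrier G" by blast
  next
    fix K g assume K: "\<forall>U\<in>K. ?P U" and "g \<in> \<Union>K"
    then obtain U where U: "U \<in> K" "g \<in> U" by blast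
    then obtain R where "invariant_entourage G \<Gamma> act R" "g <#\<^bsub>G\<^esub> action_kernel G \<Gamma> act R \<subseteq> U"
      using K by blast
    with U show "\<exists>R. invariant_entourage G \<Gamma> act R \<and> g <#\<^bsub>G\<^esub> action_kernel G \<Gamma> act R \<subseteq> \<Union>K"
      by blast
  qed
  then have "openin (topology ?P) = ?P" by (rule topology_inverse')
  then show ?thesis by (simp only: action_topology_def)
qed

text \<open>The coset \<open>C\<close> of \<open>g\<close> sends the class \<open>P\<close> of \<open>x\<close> to the class of \<open>act g x\<close>.\<close>

definition quotient_act ::
    "('g \<Rightarrow> 'a \<Rightarrow> 'a) \<Rightarrow> ('a \<times> 'a) set \<Rightarrow> 'g set \<Rightarrow> 'a set \<Rightarrow> 'a set" where
  "quotient_act act R C P = (\<Union>g\<in>C. \<Union>x\<in>P. R `` {act g x})"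

definition residually_free ::
    "('g, 'm) monoid_scheme \<Rightarrow> 'a::uniform_space pre_graph \<Rightarrow> ('g \<Rightarrow> 'a \<Rightarrow> 'a) \<Rightarrow> bool" where
  "residually_free G \<Gamma> act \<longleftrightarrow>
     (\<exists>\<F>. fundamental_system \<F> \<and>
        (\<forall>R\<in>\<F>. invariant_entourage G \<Gamma> act R \<and>
           (let Q = G Mod action_kernel G \<Gamma> act R in
             \<forall>C\<in>carrier Q. \<forall>P\<in>points \<Gamma> // R. quotient_act act R C P = P \<longrightarrow> C = \<one>\<^bsub>Q\<^esub>)))"

definition simply_transitive_on ::
    "('g, 'm) monoid_scheme \<Rightarrow> ('g \<Rightarrow> 'a \<Rightarrow> 'a) \<Rightarrow> 'a set \<Rightarrow> bool" where
  "simply_transitive_on G act S \<longleftrightarrow>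
     (\<forall>g\<in>carrier G. act g ` S \<subseteq> S) \<and>
     (\<forall>x\<in>S. \<forall>y\<in>S. \<exists>!g. g \<in> carrier G \<and> act g x = y)"

definition profinite_group :: "('g, 'm) monoid_scheme \<Rightarrow> 'g topology \<Rightarrow> bool" where
  "profinite_group G T \<longleftrightarrow>
     group G \<and> topspace T = carrier G \<and>
     continuous_map (prod_topology T T) T (\<lambda>(g, h). g \<otimes>\<^bsub>G\<^esub> h) \<and>
     continuous_map T T (\<lambda>g. inv\<^bsub>G\<^esub> g) \<and>
     compact_space T \<and> Hausdorff_space T \<and>
     (\<forall>C. connectedin T C \<longrightarrow> (\<exists>g. C \<subseteq> {g}))"

definition Aut :: "'a::topological_space pre_graph \<Rightarrow> ('a \<Rightarrow> 'b) \<Rightarrow> ('a \<Rightarrow> 'a) monoid" where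
  "Aut \<Gamma> f =
     \<lparr>carrier = {h. graph_map \<Gamma> \<Gamma> h \<and> (\<exists>k. homeomorphism UNIV UNIV h k) \<and> f \<circ> h = f},
      mult = (\<circ>),
      one = id\<rparr>"

end

theory Submission
  imports Defs
begin

text \<open>
  Write \<open>\<Gamma>\<close> as the limit of the finite graphs \<open>X i\<close>, with projections \<open>\<alpha> _ i\<close>.  Normality of the
  image of the fundamental group makes the deck transformations of each \<open>X i\<close> transitive on vertex
  fibres, and two lifts of a map on a connected graph that agree at one point are equal.  Hence deck
  transformations chosen to carry \<open>\<alpha> x i\<close> to \<open>\<alpha> y i\<close> are compatible with the transition maps and
  assemble to a covering transformation carrying \<open>x\<close> to \<open>y\<close>.  The limit \<open>\<Gamma>\<close> is itself connected, in
  the sense that a nonempty clopen set closed under incidence is everything.  Therefore a covering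
  transformation is determined modulo \<open>i\<close> by its value modulo \<open>i\<close> at one point, and it
  respects the fibres of \<open>\<alpha> _ i\<close>.  So the kernels of the projections form a fundamental system of
  invariant entourages that witnesses residual freeness, and the orbit map of a vertex is a
  homeomorphism onto its fibre, which is compact and totally disconnected.
\<close>

section \<open>Graph maps, edge paths and products of loop classes\<close>

lemma graph_map_verts: "graph_map X Y q \<Longrightarrow> v \<in> verts X \<Longrightarrow> q v \<in> verts Y"
  by (auto simp: graph_map_def)

lemma graph_map_edges: "graph_map X Y q \<Longrightarrow> e \<in> edges X \<Longrightarrow> q e \<in> edges Y"
  by (auto simp: graph_map_def)

lemma graph_map_points: "graph_map X Y q \<Longrightarrow> x \<in> points X \<Longrightarrow> q x \<in> points Y"
  by (auto simp: graph_map_def points_def)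

lemma graph_map_incidence:
  assumes "graph_map X Y q" "e \<in> edges X"
  shows "q (src X e) = src Y (q e)" "q (tgt X e) = tgt Y (q e)" "q (einv X e) = einv Y (q e)"
  using assms by (auto simp: graph_map_def)

lemma graph_map_vert_iff:
  "is_graph Y \<Longrightarrow> graph_map X Y q \<Longrightarrow> x \<in> points X \<Longrightarrow> q x \<in> verts Y \<longleftrightarrow> x \<in> verts X"
  by (auto simp: graph_map_def points_def is_graph_def)

lemma graph_map_edge_iff:
  "is_graph Y \<Longrightarrow> graph_map X Y q \<Longrightarrow> x \<in> points X \<Longrightarrow> q x \<in> edges Y \<longleftrightarrow> x \<in> edges X"
  by (auto simp: graph_map_def points_def is_graph_def)

lemma graph_map_comp:
  "graph_map Y Z g \<Longrightarrow> graph_map X Y f \<Longrightarrow> graph_map X Z (\<lambda>x. g (f x))"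
  by (auto simp: graph_map_def image_subset_iff)

lemma graph_map_id: "graph_map X X (\<lambda>x. x)"
  by (auto simp: graph_map_def)

lemma graph_edge:
  assumes "is_graph X" "e \<in> edges X"
  shows "src X e \<in> verts X" "tgt X e \<in> verts X" "einv X e \<in> edges X" "einv X (einv X e) = e"
    "einv X e \<noteq> e" "src X (einv X e) = tgt X e" "tgt X (einv X e) = src X e"
  using assms by (auto simp: is_graph_def)

lemma edge_path_end: "is_graph X \<Longrightarrow> edge_path X u p v \<Longrightarrow> v \<in> verts X"
  by (induction p arbitrary: u) auto

lemma edge_path_map:
  "graph_map X Y q \<Longrightarrow> edge_path X u p v \<Longrightarrow> edge_path Y (q u) (map q p) (q v)"
proof (induction p arbitrary: u)
  case (Cons e p)
  then show ?case
    using graph_map_edges graph_map_incidence[of X Y q e] by fastforce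
qed (auto simp: graph_map_verts)

text \<open>Each edge passes membership in \<open>A\<close> from one end to the other, so
  \<open>A\<close> spreads along edge paths and, through sources, to all edges. The set
  \<open>A\<close> will be the locus where two lifts agree, or the trace of a clopen set at a finite
  level.\<close>

lemma path_connected_incidence_closed:
  assumes X: "is_graph X" "path_connected_graph X"
    and A: "\<And>e. e \<in> edges X \<Longrightarrow> (e \<in> A \<longleftrightarrow> src X e \<in> A) \<and> (e \<in> A \<longleftrightarrow> tgt X e \<in> A)"
    and z: "z \<in> points X" "z \<in> A"
  shows "points X \<subseteq> A"
proof -
  have path: "v \<in> A" if "edge_path X u p v" "u \<in> A" for u p v
    using that by (induction p arbitrary: u) (use A in auto)
  obtain u where u: "u \<in> verts X" "u \<in> A"
    using z A graph_edge(1)[OF X(1)] by (auto simp: points_def)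
  have vA: "v \<in> A" if "v \<in> verts X" for v
    using X(2) u that path unfolding path_connected_graph_def by blast
  show ?thesis
    using vA A graph_edge(1)[OF X(1)] by (auto simp: points_def)
qed

text \<open>The product is defined as a union over all representatives. Homotopy is a congruence for
  concatenation, so all terms of the union are the same class.\<close>

lemma fundamental_group_mult:
  assumes g: "is_graph \<Gamma>" and "p \<in> loops \<Gamma> x" "q \<in> loops \<Gamma> x"
  shows "loop_homotopy \<Gamma> x `` {p} \<otimes>\<^bsub>fundamental_group \<Gamma> x\<^esub> loop_homotopy \<Gamma> x `` {q}
           = loop_homotopy \<Gamma> x `` {p @ q}"
proof -
  let ?H = "loop_homotopy \<Gamma> x"
  have eq: "equiv (loops \<Gamma> x) ?H" by (rule equiv_loop_homotopy)
  have "?H `` {p' @ q'} = ?H `` {p @ q}" if "p' \<in> ?H `` {p}" "q' \<in> ?H `` {q}" for p' q'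
    using that loop_homotopy_append[OF g, of p p' x q q'] equiv_class_eq[OF eq] by blast
  moreover have "p \<in> ?H `` {p}" "q \<in> ?H `` {q}"
    using equiv_class_self[OF eq] assms by auto
  ultimately have "(\<Union>p'\<in>?H `` {p}. \<Union>q'\<in>?H `` {q}. ?H `` {p' @ q'}) = ?H `` {p @ q}"
    by blast
  then show ?thesis by (simp only: fundamental_group_def monoid.simps)
qed

section \<open>Coverings and their deck transformations\<close>

locale covering_map =
  fixes X :: "'a pre_graph" and Y :: "'b pre_graph" and q :: "'a \<Rightarrow> 'b"
  assumes graph_X: "is_graph X" and graph_Y: "is_graph Y"
    and graph_map_q: "graph_map X Y q" and loc_bij: "locally_bijective X Y q"
begin

lemma edge_eqI:
  assumes "e \<in> edges X" "e' \<in> edges X" "src X e = src X e'" "q e = q e'"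
  shows "e = e'"
proof -
  have "bij_betw q {d \<in> edges X. src X d = src X e} {d \<in> edges Y. src Y d = q (src X e)}"
    using loc_bij graph_edge(1)[OF graph_X assms(1)] by (auto simp: locally_bijective_def)
  then show ?thesis using assms by (auto simp: bij_betw_def inj_on_def)
qed

lemma edge_lift:
  assumes "v \<in> verts X" "e \<in> edges Y" "src Y e = q v"
  obtains e' where "e' \<in> edges X" "src X e' = v" "q e' = e"
proof -
  have "bij_betw q {d \<in> edges X. src X d = v} {d \<in> edges Y. src Y d = q v}"
    using loc_bij assms by (auto simp: locally_bijective_def)
  then have "e \<in> q ` {d \<in> edges X. src X d = v}" using assms by (auto simp: bij_betw_def)
  then show ?thesis using that by blast
qed

text \<open>Agreement at the source forces agreement on the edge, by injectivity of \<open>q\<close>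
  on the edges leaving a vertex; the target is handled through the reversed edge. Both the finite
  graphs and \<Gamma> will play the role of \<open>Z\<close>.\<close>

lemma lifts_agree_incidence:
  assumes Z: "is_graph Z" and u: "graph_map Z X u" and w: "graph_map Z X w"
    and e: "e \<in> edges Z" and q: "q (u e) = q (w e)"
  shows "u e = w e \<longleftrightarrow> u (src Z e) = w (src Z e)" "u e = w e \<longleftrightarrow> u (tgt Z e) = w (tgt Z e)"
proof -
  have *: "u d = w d" if "d \<in> edges Z" "q (u d) = q (w d)" "u (src Z d) = w (src Z d)" for d
    using edge_eqI[of "u d" "w d"] that graph_map_edges[OF u] graph_map_edges[OF w]
      graph_map_incidence[OF u, of d] graph_map_incidence[OF w, of d] by metis
  then show "u e = w e \<longleftrightarrow> u (src Z e) = w (src Z e)"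
    using e q graph_map_incidence[OF u e] graph_map_incidence[OF w e] by auto
  note ie = graph_edge[OF Z e]
  have "q (u (einv Z e)) = q (w (einv Z e))"
    using e q graph_map_incidence[OF u e] graph_map_incidence[OF w e]
      graph_map_incidence[OF graph_map_q graph_map_edges[OF u e]]
      graph_map_incidence[OF graph_map_q graph_map_edges[OF w e]] by simp
  then have "u (tgt Z e) = w (tgt Z e) \<Longrightarrow> u (einv Z e) = w (einv Z e)"
    using *[OF ie(3)] ie by simp
  then show "u e = w e \<longleftrightarrow> u (tgt Z e) = w (tgt Z e)"
    using e q graph_map_incidence[OF u e] graph_map_incidence[OF w e]
      graph_map_incidence[OF u ie(3)] graph_map_incidence[OF w ie(3)] ie(4) by metis
qed

lemma lifts_eq:
  assumes Z: "is_graph Z" "path_connected_graph Z" and u: "graph_map Z X u" and w: "graph_map Z X w"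
    and q: "\<And>z. z \<in> points Z \<Longrightarrow> q (u z) = q (w z)"
    and z: "z \<in> points Z" "u z = w z" and y: "y \<in> points Z"
  shows "u y = w y"
proof -
  have "points Z \<subseteq> {y. u y = w y}"
    by (rule path_connected_incidence_closed[OF Z _ z(1)])
      (use lifts_agree_incidence[OF Z(1) u w _ q] z in \<open>auto simp: points_def\<close>)
  then show ?thesis using y by blast
qed

section \<open>Path lifting and monodromy\<close>

lemma path_lift:
  assumes "v \<in> verts X" "edge_path Y (q v) p y"
  obtains p' v' where "edge_path X v p' v'" "map q p' = p" "q v' = y"
proof -
  have "\<exists>p' v'. edge_path X v p' v' \<and> map q p' = p \<and> q v' = y" using assms
  proof (induction p arbitrary: v)
    case (Cons e p)
    then obtain e' where e': "e' \<in> edges X" "src X e' = v" "q e' = e"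
      using edge_lift[of v e] by auto
    have "edge_path Y (q (tgt X e')) p y"
      using Cons.prems e' graph_map_incidence[OF graph_map_q e'(1)] by simp
    then obtain p' v' where "edge_path X (tgt X e') p' v'" "map q p' = p" "q v' = y"
      using Cons.IH graph_edge(2)[OF graph_X e'(1)] by blast
    then show ?case using e' by (intro exI[of _ "e' # p'"] exI[of _ v']) auto
  qed auto
  then show ?thesis using that by blast
qed

lemma path_lift_unique:
  assumes "edge_path X v p a" "edge_path X v p' a'" "map q p = map q p'"
  shows "p = p' \<and> a = a'"
  using assms
proof (induction p arbitrary: v p')
  case (Cons e p)
  then obtain e' r where r: "p' = e' # r" "q e = q e'" "map q p = map q r" by (cases p') auto
  then have "e = e'" using Cons.prems edge_eqI by auto
  then show ?case using Cons.IH[of "tgt X e" r] Cons.prems r by auto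
qed auto

text \<open>The monodromy of a path, with the endpoint encoded as a set: by unique path lifting
  there is at most one element, and none if there is no lift. Concatenation becomes a union.\<close>

definition lift_ends :: "'a \<Rightarrow> 'b list \<Rightarrow> 'a set" where
  "lift_ends v p = {v'. \<exists>p'. edge_path X v p' v' \<and> map q p' = p}"

lemma lift_ends_append: "lift_ends v (p @ r) = (\<Union>w\<in>lift_ends v p. lift_ends w r)"
proof (intro equalityI subsetI)
  fix z assume "z \<in> lift_ends v (p @ r)"
  then obtain s where "edge_path X v s z" "map q s = p @ r" by (auto simp: lift_ends_def)
  then obtain s1 s2 w where "edge_path X v s1 w" "edge_path X w s2 z" "map q s1 = p" "map q s2 = r"
    by (auto simp: map_eq_append_conv edge_path_append[OF graph_X])
  then show "z \<in> (\<Union>w\<in>lift_ends v p. lift_ends w r)" unfolding lift_ends_def by blast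
next
  fix z assume "z \<in> (\<Union>w\<in>lift_ends v p. lift_ends w r)"
  then obtain s1 s2 w where "edge_path X v s1 w" "map q s1 = p" "edge_path X w s2 z" "map q s2 = r"
    by (auto simp: lift_ends_def)
  then have "edge_path X v (s1 @ s2) z" "map q (s1 @ s2) = p @ r"
    by (auto simp: edge_path_append[OF graph_X])
  then show "z \<in> lift_ends v (p @ r)" unfolding lift_ends_def by blast
qed

text \<open>At the end of a lift \<open>d\<close> of \<open>e\<close>, the only edge above
  \<open>einv Y e\<close> is \<open>einv X d\<close>, which leads back to \<open>v\<close>.\<close>

lemma lift_ends_backtrack_edges:
  assumes v: "v \<in> verts X" and e: "e \<in> edges Y" "src Y e = q v"
  shows "lift_ends v [e, einv Y e] = {v}"
proof -
  have ends: "w = v" if d: "d \<in> edges X" "src X d = v" "q d = e"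
    and c: "c \<in> edges X" "src X c = tgt X d" "q c = einv Y e" "w = tgt X c" for c d w
  proof -
    have "c = einv X d"
      using edge_eqI[of c "einv X d"] c d graph_edge[OF graph_X d(1)]
        graph_map_incidence[OF graph_map_q d(1)] by simp
    then show ?thesis using c d graph_edge[OF graph_X d(1)] by simp
  qed
  obtain d where d: "d \<in> edges X" "src X d = v" "q d = e" using edge_lift[OF v e] .
  have "edge_path X v [d, einv X d] v" "map q [d, einv X d] = [e, einv Y e]"
    using d v graph_edge[OF graph_X d(1)] graph_map_incidence[OF graph_map_q d(1)] by auto
  then have "v \<in> lift_ends v [e, einv Y e]"
    unfolding lift_ends_def mem_Collect_eq by (intro exI conjI)
  moreover have "lift_ends v [e, einv Y e] \<subseteq> {v}"
    unfolding lift_ends_def using ends by (auto simp: map_eq_Cons_conv)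
  ultimately show ?thesis by blast
qed

text \<open>The inserted backtrack returns to the vertex \<open>w\<close> where the lift of the
  prefix \<open>a\<close> ends, so the suffix \<open>b\<close> is lifted from the same vertex in
  both cases.\<close>

lemma lift_ends_backtrack:
  assumes x: "x \<in> verts X" and b: "(r, s) \<in> backtrack Y (q x)"
  shows "lift_ends x r = lift_ends x s"
proof -
  obtain a e b where e: "e \<in> edges Y" and r: "r = a @ b" and s: "s = a @ [e, einv Y e] @ b"
    and l: "edge_path Y (q x) s (q x)"
    using b by (auto simp: backtrack_def loops_def)
  have "lift_ends w [e, einv Y e] = {w}" if w: "w \<in> lift_ends x a" for w
  proof -
    obtain p' where p': "edge_path X x p' w" "map q p' = a" using w by (auto simp: lift_ends_def)
    obtain v where v: "edge_path Y (q x) a v" "edge_path Y v ([e, einv Y e] @ b) (q x)"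
      using l unfolding s edge_path_append[OF graph_Y] by blast
    have "edge_path Y (q x) a (q w)" using edge_path_map[OF graph_map_q p'(1)] p' by simp
    \<comment> \<open>The end of an edge path is determined by its start and its edges; hence
      \<open>e\<close> starts at \<open>q w\<close>.\<close>
    moreover have "v = v'" if "edge_path Y u c v" "edge_path Y u c v'" for u c v v'
      using that by (induction c arbitrary: u) auto
    ultimately have "src Y e = q w" using v by auto
    then show ?thesis using lift_ends_backtrack_edges e edge_path_end[OF graph_X p'(1)] by blast
  qed
  then show ?thesis unfolding r s lift_ends_append by auto
qed

text \<open>Homotopy is generated by inserting and deleting single backtracks, and neither moves the
  end of a lift.\<close>

lemma lift_ends_homotopic:
  assumes x: "x \<in> verts X" and h: "(r, s) \<in> loop_homotopy Y (q x)"
  shows "lift_ends x r = lift_ends x s"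
proof -
  have "(r, s) \<in> (backtrack Y (q x) \<union> (backtrack Y (q x))\<inverse>)\<^sup>*"
    using h by (auto simp: loop_homotopy_def)
  then show ?thesis
    by induction (use lift_ends_backtrack[OF x] in auto)
qed

lemma loop_map_homotopic:
  assumes h: "(r, s) \<in> loop_homotopy X x"
  shows "(map q r, map q s) \<in> loop_homotopy Y (q x)"
proof -
  have m: "map q p \<in> loops Y (q x)" if "p \<in> loops X x" for p
    using that edge_path_map[OF graph_map_q] by (auto simp: loops_def)
  have b: "(map q r, map q s) \<in> backtrack Y (q x)" if rs_b: "(r, s) \<in> backtrack X x" for r s
  proof -
    obtain a e b where e: "e \<in> edges X" and rs: "r = a @ b" "s = a @ [e, einv X e] @ b"
      and l: "r \<in> loops X x" "s \<in> loops X x"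
      using rs_b unfolding backtrack_def by blast
    have "map q r = map q a @ map q b \<and> map q s = map q a @ [q e, einv Y (q e)] @ map q b"
      using rs graph_map_incidence[OF graph_map_q e] by simp
    then show ?thesis
      using m[OF l(1)] m[OF l(2)] graph_map_edges[OF graph_map_q e]
      unfolding backtrack_def by blast
  qed
  have "(r, s) \<in> (backtrack X x \<union> (backtrack X x)\<inverse>)\<^sup>*" and l: "r \<in> loops X x" "s \<in> loops X x"
    using h by (auto simp: loop_homotopy_def)
  from this(1) have "(map q r, map q s) \<in> (backtrack Y (q x) \<union> (backtrack Y (q x))\<inverse>)\<^sup>*"
    by (induction rule: rtrancl_induct) (use b in \<open>auto intro: rtrancl_into_rtrancl\<close>)
  then show ?thesis using m l by (auto simp: loop_homotopy_def)
qed

text \<open>\<open>induced_hom\<close> is a union over representatives; since images of homotopic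
  loops are homotopic, one representative determines it.\<close>

lemma induced_hom_class:
  assumes "p \<in> loops X x"
  shows "induced_hom Y q x (loop_homotopy X x `` {p}) = loop_homotopy Y (q x) `` {map q p}"
proof -
  have "loop_homotopy Y (q x) `` {map q r} = loop_homotopy Y (q x) `` {map q p}"
    if "r \<in> loop_homotopy X x `` {p}" for r
    using that by (intro equiv_class_eq[OF equiv_loop_homotopy, symmetric] loop_map_homotopic) simp
  moreover have "p \<in> loop_homotopy X x `` {p}"
    using equiv_class_self[OF equiv_loop_homotopy assms] .
  ultimately show ?thesis unfolding induced_hom_def by blast
qed

text \<open>
  Normality is used in the form \<open>c H = H c\<close>, where the loop \<open>c\<close> is the image of a path from
  \<open>x\<close> to \<open>v\<close>: a loop that lifts to a loop at \<open>x\<close> then does so at \<open>v\<close> as well.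
\<close>

lemma normal_lift_closed_base:
  assumes x: "x \<in> verts X" and pc: "path_connected_graph X"
    and N: "induced_hom Y q x ` carrier (fundamental_group X x) \<lhd> fundamental_group Y (q x)"
    and v: "v \<in> verts X" "q v = q x" and p: "p \<in> loops X x"
  shows "v \<in> lift_ends v (map q p)"
proof -
  let ?H = "induced_hom Y q x ` carrier (fundamental_group X x)"
  let ?P = "fundamental_group Y (q x)"
  let ?c = "\<lambda>r. loop_homotopy Y (q x) `` {r}"
  obtain d where d: "edge_path X x d v" using pc x v by (auto simp: path_connected_graph_def)
  have cl: "map q d \<in> loops Y (q x)"
    using edge_path_map[OF graph_map_q d] v by (simp add: loops_def)
  have ml: "map q r \<in> loops Y (q x)" if "r \<in> loops X x" for r
    using that edge_path_map[OF graph_map_q] by (auto simp: loops_def)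
  have "carrier (fundamental_group X x) = (\<lambda>r. loop_homotopy X x `` {r}) ` loops X x"
    by (auto simp: fundamental_group_def quotient_def)
  then have "?H = (\<lambda>r. ?c (map q r)) ` loops X x"
    using induced_hom_class by (simp add: image_image)
  then have H: "A \<in> ?H \<longleftrightarrow> (\<exists>r\<in>loops X x. A = ?c (map q r))" for A
    by (simp add: image_iff)
  have "?c (map q d) \<in> carrier ?P" using cl by (auto simp: fundamental_group_def quotient_def)
  then have eq: "?H #>\<^bsub>?P\<^esub> ?c (map q d) = ?c (map q d) <#\<^bsub>?P\<^esub> ?H"
    using normal.coset_eq[OF N] by blast
  have "?c (map q p) \<in> ?H" using H p by blast
  then have "?c (map q d) \<otimes>\<^bsub>?P\<^esub> ?c (map q p) \<in> ?c (map q d) <#\<^bsub>?P\<^esub> ?H"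
    by (auto simp: l_coset_def)
  then have "?c (map q d @ map q p) \<in> ?H #>\<^bsub>?P\<^esub> ?c (map q d)"
    using eq fundamental_group_mult[OF graph_Y cl ml[OF p]] by simp
  then obtain A where A: "A \<in> ?H" "?c (map q d @ map q p) = A \<otimes>\<^bsub>?P\<^esub> ?c (map q d)"
    unfolding r_coset_def UN_iff singleton_iff by (elim bexE)
  obtain r where "r \<in> loops X x" "A = ?c (map q r)"
    using A(1) unfolding H by (elim bexE)
  with A have r: "r \<in> loops X x" "?c (map q d @ map q p) = ?c (map q r) \<otimes>\<^bsub>?P\<^esub> ?c (map q d)"
    by simp_all
  then have "?c (map q d @ map q p) = ?c (map q r @ map q d)"
    using fundamental_group_mult[OF graph_Y ml[OF r(1)] cl] by simp
  then have "(map q d @ map q p, map q r @ map q d) \<in> loop_homotopy Y (q x)"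
    by (rule eq_equiv_class[OF _ equiv_loop_homotopy]) (intro loops_append[OF graph_Y] ml r(1) cl)
  then have ends: "lift_ends x (map q d @ map q p) = lift_ends x (map q r @ map q d)"
    by (rule lift_ends_homotopic[OF x])
  \<comment> \<open>The path \<open>r @ d\<close> lifts the right-hand loop and ends at
    \<open>v\<close>, so by homotopy the lift of the left-hand loop ends at \<open>v\<close> too.
    Its first part is \<open>d\<close>, which already reaches \<open>v\<close>; hence its second
    part, a lift of the image of \<open>p\<close>, is closed at \<open>v\<close>.\<close>
  have "edge_path X x (r @ d) v" using r d by (auto simp: loops_def edge_path_append[OF graph_X])
  then have "v \<in> lift_ends x (map q r @ map q d)"
    unfolding lift_ends_def by (metis (mono_tags, lifting) map_append mem_Collect_eq)
  then have "v \<in> lift_ends x (map q d @ map q p)" using ends by simp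
  moreover have "lift_ends x (map q d) \<subseteq> {v}"
    using path_lift_unique[OF _ d] by (auto simp: lift_ends_def)
  ultimately show ?thesis by (auto simp: lift_ends_append)
qed

lemma map_rev_einv: "set p \<subseteq> edges X \<Longrightarrow> map q (rev (map (einv X) p)) = rev (map (einv Y) (map q p))"
  using graph_map_incidence(3)[OF graph_map_q] by (auto simp: rev_map)

end

section \<open>Consequences of normality: closed lifts and deck transformations\<close>

locale regular_covering_map = covering_map +
  assumes connected_X: "path_connected_graph X"
    and regular: "\<exists>x\<in>verts X. induced_hom Y q x ` carrier (fundamental_group X x)
                    \<lhd> fundamental_group Y (q x)"
begin

text \<open>Normality is given at one base vertex \<open>x\<close>. Conjugating \<open>p\<close> by
  a path \<open>d\<close> from \<open>x\<close> to \<open>u\<close> gives a loop at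
  \<open>x\<close>; its image has a closed lift at a suitable vertex \<open>w\<close> above
  \<open>q x\<close>, and the middle piece of that lift is \<open>p'\<close>.\<close>

lemma lift_closed:
  assumes u: "edge_path X u p u" and v: "edge_path X v p' v'" and "q u = q v" "map q p = map q p'"
  shows "v' = v"
proof -
  obtain x where x: "x \<in> verts X"
    and N: "induced_hom Y q x ` carrier (fundamental_group X x) \<lhd> fundamental_group Y (q x)"
    using regular by blast
  have uX: "u \<in> verts X" and vX: "v \<in> verts X"
    using edge_path_start[OF graph_X u] edge_path_start[OF graph_X v] .
  obtain d where d: "edge_path X x d u"
    using connected_X x uX by (auto simp: path_connected_graph_def)
  let ?r = "\<lambda>d. rev (map (einv X) d)"
  have rd: "edge_path X u (?r d) x" using edge_path_rev[OF graph_X d] .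
  have "edge_path Y (q v) (map q (?r d)) (q x)"
    using edge_path_map[OF graph_map_q rd] assms(3) by simp
  \<comment> \<open>\<open>c\<close> is the copy at \<open>v\<close> of the reversed
    \<open>d\<close>. Its reverse lifts the image of \<open>d\<close> from \<open>w\<close> to
    \<open>v\<close>.\<close>
  then obtain c w where c: "edge_path X v c w" "map q c = map q (?r d)" "q w = q x"
    using path_lift[OF vX] by metis
  have wX: "w \<in> verts X" using edge_path_end[OF graph_X c(1)] .
  have rc: "edge_path X w (?r c) v" using edge_path_rev[OF graph_X c(1)] .
  have "d @ p @ ?r d \<in> loops X x"
    using d u rd by (auto simp: loops_def edge_path_append[OF graph_X])
  then have "w \<in> lift_ends w (map q (d @ p @ ?r d))"
    using normal_lift_closed_base[OF x connected_X N wX c(3)] by blast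
  moreover have rr: "rev (map (einv Y) (rev (map (einv Y) (map q s)))) = map q s"
    if "set s \<subseteq> edges X" for s
    using that graph_edge(4)[OF graph_Y] graph_map_edges[OF graph_map_q]
    by (auto simp: rev_map subset_iff)
  then have qrc: "map q (?r c) = map q d"
    using map_rev_einv[of c] map_rev_einv[of d] c(2) edge_path_edges[OF c(1)] edge_path_edges[OF d]
    by metis
  ultimately obtain w1 w2 where w1: "w1 \<in> lift_ends w (map q d)" and w2: "w2 \<in> lift_ends w1 (map q p)"
    and w3: "w \<in> lift_ends w2 (map q (?r d))"
    unfolding map_append lift_ends_append by blast
  have "w1 = v"
    using w1 path_lift_unique[OF _ rc] qrc unfolding lift_ends_def by auto
  then have "w2 = v'"
    using w2 path_lift_unique[OF _ v] assms(4) unfolding lift_ends_def by auto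
  then obtain s where s: "edge_path X v' s w" "map q s = map q (?r d)"
    using w3 unfolding lift_ends_def by blast
  \<comment> \<open>The reverses of \<open>s\<close> and \<open>c\<close> both lift the image of
    \<open>d\<close> from \<open>w\<close>, so their ends \<open>v'\<close> and \<open>v\<close>
    coincide.\<close>
  have rs: "edge_path X w (?r s) v'" using edge_path_rev[OF graph_X s(1)] .
  have "map q (?r s) = map q (?r c)"
    using map_rev_einv[of s] map_rev_einv[of c] c(2) s(2) edge_path_edges[OF c(1)] edge_path_edges[OF s(1)]
    by metis
  then show ?thesis using path_lift_unique[OF rs rc] by blast
qed

text \<open>The end of a path from \<open>u\<close> is sent to the end of the lift of its image at
  \<open>v\<close>; \<open>lift_closed\<close> makes this independent of the path.\<close>

lemma deck_transformation:
  assumes u: "u \<in> verts X" and v: "v \<in> verts X" and "q u = q v"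
  obtains h where "graph_map X X h" "\<And>z. z \<in> points X \<Longrightarrow> q (h z) = q z" "h u = v"
proof -
  define rel where "rel w w' \<longleftrightarrow>
    (\<exists>p p'. edge_path X u p w \<and> edge_path X v p' w' \<and> map q p = map q p')" for w w'
  have ex: "\<exists>w'. rel w w'" if w: "w \<in> verts X" for w
  proof -
    obtain p where p: "edge_path X u p w"
      using connected_X u w unfolding path_connected_graph_def by blast
    then have "edge_path Y (q v) (map q p) (q w)"
      using edge_path_map[OF graph_map_q p] assms by simp
    then obtain p' w' where "edge_path X v p' w'" "map q p' = map q p"
      using path_lift[OF v] by metis
    then show ?thesis using p unfolding rel_def by metis
  qed
  have rel_q: "q w = q w'" if ww': "rel w w'" for w w'
  proof -
    obtain p p' where p: "edge_path X u p w" "edge_path X v p' w'" "map q p = map q p'"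
      using ww' unfolding rel_def by blast
    have "edge_path Y (q u) (map q p) (q w)" "edge_path Y (q u) (map q p) (q w')"
      using edge_path_map[OF graph_map_q p(1)] edge_path_map[OF graph_map_q p(2)] p(3) assms(3) by auto
    moreover have "a = b" if "edge_path Y c r a" "edge_path Y c r b" for a b c r
      using that by (induction r arbitrary: c) auto
    ultimately show ?thesis by blast
  qed
  \<comment> \<open>Two paths \<open>p\<close> and \<open>r\<close> from \<open>u\<close> to
    \<open>w\<close> form a loop at \<open>w\<close>. The corresponding path at \<open>a\<close>
    leads to \<open>b\<close> and is closed by \<open>lift_closed\<close>.\<close>
  have uniq: "a = b" if wa: "rel w a" and wb: "rel w b" for w a b
  proof -
    obtain p p' where p: "edge_path X u p w" "edge_path X v p' a" "map q p = map q p'"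
      using wa unfolding rel_def by blast
    obtain r r' where r: "edge_path X u r w" "edge_path X v r' b" "map q r = map q r'"
      using wb unfolding rel_def by blast
    have loop: "edge_path X w (rev (map (einv X) p) @ r) w"
      using edge_path_rev[OF graph_X p(1)] r(1) by (auto simp: edge_path_append[OF graph_X])
    have "edge_path X a (rev (map (einv X) p') @ r') b"
      using edge_path_rev[OF graph_X p(2)] r(2) by (auto simp: edge_path_append[OF graph_X])
    moreover have "map q (rev (map (einv X) p) @ r) = map q (rev (map (einv X) p') @ r')"
      using p r map_rev_einv[of p] map_rev_einv[of p'] edge_path_edges[OF p(1)] edge_path_edges[OF p(2)]
      by (simp only: map_append)
    ultimately show ?thesis
      using lift_closed[OF loop] rel_q[OF wa] by metis
  qed
  have rel_verts: "w' \<in> verts X" if "rel w w'" for w w'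
    using that edge_path_end[OF graph_X] unfolding rel_def by blast
  define hv where "hv w = (THE w'. rel w w')" for w
  have hv: "rel w (hv w)" if "w \<in> verts X" for w
    unfolding hv_def using ex[OF that] uniq by (metis the_equality)
  \<comment> \<open>An edge goes to the edge above \<open>q e\<close> leaving the image of its
    source; local bijectivity gives existence and uniqueness.\<close>
  define he where "he e = (THE e'. e' \<in> edges X \<and> src X e' = hv (src X e) \<and> q e' = q e)" for e
  have he: "he e \<in> edges X \<and> src X (he e) = hv (src X e) \<and> q (he e) = q e" if e: "e \<in> edges X" for e
  proof -
    have s: "rel (src X e) (hv (src X e))" using hv graph_edge(1)[OF graph_X e] .
    have "src Y (q e) = q (hv (src X e))"
      using rel_q[OF s] graph_map_incidence[OF graph_map_q e] by simp
    then obtain e' where "e' \<in> edges X" "src X e' = hv (src X e)" "q e' = q e"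
      using edge_lift[OF rel_verts[OF s] graph_map_edges[OF graph_map_q e]] by metis
    then have "\<exists>!e'. e' \<in> edges X \<and> src X e' = hv (src X e) \<and> q e' = q e"
      using edge_eqI by metis
    then show ?thesis unfolding he_def by (rule theI')
  qed
  have tgt: "tgt X (he e) = hv (tgt X e)" if e: "e \<in> edges X" for e
  proof -
    have "rel (src X e) (hv (src X e))" using hv graph_edge(1)[OF graph_X e] .
    then obtain p p' where p: "edge_path X u p (src X e)" "edge_path X v p' (hv (src X e))" "map q p = map q p'"
      unfolding rel_def by blast
    have "edge_path X u (p @ [e]) (tgt X e)" "edge_path X v (p' @ [he e]) (tgt X (he e))"
      using p he[OF e] e graph_edge(2)[OF graph_X] by (auto simp: edge_path_append[OF graph_X])
    moreover have "map q (p @ [e]) = map q (p' @ [he e])" using p he[OF e] by simp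
    ultimately have "rel (tgt X e) (tgt X (he e))" unfolding rel_def by blast
    then show ?thesis using uniq hv graph_edge(2)[OF graph_X e] by blast
  qed
  \<comment> \<open>Both edges start at \<open>hv (tgt X e)\<close> and have the same image under
    \<open>q\<close>.\<close>
  have inv: "he (einv X e) = einv X (he e)" if e: "e \<in> edges X" for e
  proof (rule edge_eqI)
    have ie: "einv X e \<in> edges X" using graph_edge[OF graph_X e] by simp
    show "he (einv X e) \<in> edges X" using he[OF ie] by simp
    show "einv X (he e) \<in> edges X" using he[OF e] graph_edge[OF graph_X] by blast
    have h: "he e \<in> edges X" using he[OF e] by simp
    show "src X (he (einv X e)) = src X (einv X (he e))"
      using he[OF ie] tgt[OF e] graph_edge[OF graph_X e] graph_edge[OF graph_X h] by simp
    show "q (he (einv X e)) = q (einv X (he e))"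
      using he[OF ie] he[OF e] graph_map_incidence[OF graph_map_q e] graph_map_incidence[OF graph_map_q h]
      by simp
  qed
  define h where "h z = (if z \<in> verts X then hv z else he z)" for z
  have disj: "verts X \<inter> edges X = {}" using graph_X by (simp add: is_graph_def)
  have hE: "h e = he e" if "e \<in> edges X" for e using that disj by (auto simp: h_def)
  have hV: "h w = hv w" if "w \<in> verts X" for w using that by (simp add: h_def)
  have "graph_map X X h"
    unfolding graph_map_def
    using hE hV he rel_verts[OF hv] inv tgt graph_edge[OF graph_X] by auto
  moreover have "q (h z) = q z" if "z \<in> points X" for z
    using that hE hV he rel_q[OF hv] by (auto simp: points_def)
  moreover have "rel u v" unfolding rel_def using u v by (intro exI[of _ "[]"]) auto
  then have "h u = v" using hV[OF u] hv[OF u] uniq by simp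
  ultimately show ?thesis using that by blast
qed

end

lemma finite_regular_covering_imp_regular_covering_map:
  assumes "finite_regular_covering X Y q"
  shows "regular_covering_map X Y q"
  using assms
  unfolding finite_regular_covering_def regular_covering_map_def covering_map_def
    regular_covering_map_axioms_def by auto

section \<open>Limits of finite graphs\<close>

text \<open>Every class of \<open>E\<close> contains, around each of its points \<open>x\<close>, a
  class of some \<open>R x\<close> in the family. Finitely many of these classes cover the space,
  and a member \<open>T\<close> below the finitely many relations involved refines \<open>E\<close>:
  points related by \<open>T\<close> lie in a common covering class. This is applied to kernels of
  projections and to compatible cofinite entourages.\<close>

lemma refine_open_equivalence:
  fixes E :: "('a::topological_space \<times> 'a) set"
  assumes comp: "compact (UNIV :: 'a set)"
    and E: "equiv UNIV E" "\<And>x. open (E `` {x})"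
    and F: "\<And>R. R \<in> \<F> \<Longrightarrow> equiv UNIV R" "\<And>R x. R \<in> \<F> \<Longrightarrow> open (R `` {x})"
    and ne: "\<F> \<noteq> {}" and dir: "\<And>R S. R \<in> \<F> \<Longrightarrow> S \<in> \<F> \<Longrightarrow> \<exists>T\<in>\<F>. T \<subseteq> R \<inter> S"
    and basis: "\<And>x U. open U \<Longrightarrow> x \<in> U \<Longrightarrow> \<exists>R\<in>\<F>. R `` {x} \<subseteq> U"
  shows "\<exists>R\<in>\<F>. R \<subseteq> E"
proof -
  have "\<exists>R\<in>\<F>. R `` {x} \<subseteq> E `` {x}" for x
    using basis[OF E(2)] equiv_class_self[OF E(1)] by blast
  then obtain R where R: "R x \<in> \<F>" "R x `` {x} \<subseteq> E `` {x}" for x by metis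
  have op: "open (R x `` {x})" for x using F(2) R(1) by blast
  have self: "x \<in> R x `` {x}" for x using equiv_class_self[OF F(1)] R(1) by blast
  obtain C where C: "finite C" "UNIV \<subseteq> (\<Union>x\<in>C. R x `` {x})"
  proof (rule compactE_image[OF comp, of UNIV "\<lambda>x. R x `` {x}"])
    show "UNIV \<subseteq> (\<Union>x. R x `` {x})" using self by blast
  qed (use op in auto)
  have "\<exists>T\<in>\<F>. T \<subseteq> (\<Inter>x\<in>C. R x)" using C(1)
  proof induction
    case empty
    then show ?case using ne by auto
  next
    case (insert x C)
    then obtain T where T: "T \<in> \<F>" "T \<subseteq> (\<Inter>x\<in>C. R x)" by blast
    then show ?case using dir[OF R(1)[of x] T(1)] by (simp only: INT_insert) (meson Int_mono order_refl order_trans)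
  qed
  then obtain T where T: "T \<in> \<F>" "T \<subseteq> (\<Inter>x\<in>C. R x)" by blast
  have "(y, z) \<in> E" if yz: "(y, z) \<in> T" for y z
  proof -
    obtain c where c: "c \<in> C" "(c, y) \<in> R c" using C(2) by blast
    moreover have "(y, z) \<in> R c" using yz T(2) c by blast
    ultimately have "(c, z) \<in> R c"
      using F(1)[OF R(1)[of c]] by (meson equivE transD)
    then have "(c, y) \<in> E" "(c, z) \<in> E" using c R(2) by blast+
    then show ?thesis using E(1) by (meson equivE symD transD)
  qed
  then have "T \<subseteq> E" by (simp add: subrelI)
  then show ?thesis using T(1) by blast
qed

lemma directed_index_upper_bound:
  assumes "directed_index I below" "finite C" "C \<subseteq> I"
  shows "\<exists>k\<in>I. \<forall>c\<in>C. below c k"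
  using assms(2,3)
proof induction
  case empty
  then show ?case using assms(1) unfolding directed_index_def by blast
next
  case (insert x C)
  then obtain k where k: "k \<in> I" "\<forall>c\<in>C. below c k" by blast
  obtain l where l: "l \<in> I" "below x l" "below k l"
    using assms(1) insert.prems k(1) unfolding directed_index_def by (meson insert_subset)
  have "below c l" if "c \<in> C" for c
    using assms(1) k l that insert.prems unfolding directed_index_def by (meson insert_subset subsetD)
  then show ?case using l by blast
qed

section \<open>Points and topology of a limit\<close>

locale graph_limit =
  fixes I :: "'i set" and below :: "'i \<Rightarrow> 'i \<Rightarrow> bool"
    and X :: "'i \<Rightarrow> 'c pre_graph" and \<phi> :: "'i \<Rightarrow> 'i \<Rightarrow> 'c \<Rightarrow> 'c"
    and \<Gamma> :: "'a::topological_space pre_graph" and \<alpha> :: "'a \<Rightarrow> 'i \<Rightarrow> 'c"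
  assumes directed: "directed_index I below"
    and system: "graph_inverse_system I below X \<phi>"
    and finite_points: "i \<in> I \<Longrightarrow> finite (points (X i))"
    and connected: "i \<in> I \<Longrightarrow> path_connected_graph (X i)"
    and iso: "limit_iso I below X \<phi> \<Gamma> \<alpha>"
    and graph_\<Gamma>: "is_graph \<Gamma>" and points_\<Gamma>: "points \<Gamma> = UNIV"
begin

lemma graph_X: "i \<in> I \<Longrightarrow> is_graph (X i)"
  using system by (auto simp: graph_inverse_system_def)

lemma phi_map: "i \<in> I \<Longrightarrow> j \<in> I \<Longrightarrow> below i j \<Longrightarrow> graph_map (X j) (X i) (\<phi> i j)"
  using system by (auto simp: graph_inverse_system_def)

lemma phi_phi: "i \<in> I \<Longrightarrow> j \<in> I \<Longrightarrow> k \<in> I \<Longrightarrow> below i j \<Longrightarrow> below j k \<Longrightarrow> x \<in> points (X k) \<Longrightarrow>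
    \<phi> i j (\<phi> j k x) = \<phi> i k x"
  using system unfolding graph_inverse_system_def by blast

lemma below_refl: "i \<in> I \<Longrightarrow> below i i"
  and below_trans: "i \<in> I \<Longrightarrow> j \<in> I \<Longrightarrow> k \<in> I \<Longrightarrow> below i j \<Longrightarrow> below j k \<Longrightarrow> below i k"
  using directed unfolding directed_index_def by blast+

lemma below_upper: "i \<in> I \<Longrightarrow> j \<in> I \<Longrightarrow> \<exists>k\<in>I. below i k \<and> below j k"
  using directed unfolding directed_index_def by blast

lemma alpha_limit_map: "graph_map \<Gamma> (limit_graph I below X \<phi>) \<alpha>"
  using iso by (simp add: limit_iso_def)

lemma alpha_homeomorphic: "homeomorphic_map euclidean (limit_topology I below X \<phi>) \<alpha>"
  using iso by (simp add: limit_iso_def)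

lemma alpha_limit: "\<alpha> x \<in> points (limit_graph I below X \<phi>)"
  using graph_map_points[OF alpha_limit_map] points_\<Gamma> by auto

lemma alpha_points: "i \<in> I \<Longrightarrow> \<alpha> x i \<in> points (X i)"
  using alpha_limit[of x] by (auto simp: limit_graph_def points_def)

lemma alpha_map: "i \<in> I \<Longrightarrow> graph_map \<Gamma> (X i) (\<lambda>x. \<alpha> x i)"
  using alpha_limit_map unfolding graph_map_def by (auto simp: limit_graph_def image_subset_iff)

lemma alpha_phi: "i \<in> I \<Longrightarrow> j \<in> I \<Longrightarrow> below i j \<Longrightarrow> \<phi> i j (\<alpha> x j) = \<alpha> x i"
  using alpha_limit[of x] by (auto simp: limit_graph_def points_def)

lemma alpha_below: "i \<in> I \<Longrightarrow> j \<in> I \<Longrightarrow> below i j \<Longrightarrow> \<alpha> x j = \<alpha> y j \<Longrightarrow> \<alpha> x i = \<alpha> y i"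
  using alpha_phi by metis

lemma alpha_extensional: "\<alpha> x \<in> extensional I"
  using alpha_limit[of x] by (auto simp: limit_graph_def points_def PiE_def)

lemma limit_points_subset: "points (limit_graph I below X \<phi>) \<subseteq> (\<Pi>\<^sub>E i\<in>I. points (X i))"
  by (auto simp: limit_graph_def points_def PiE_def Pi_def)

lemma topspace_limit: "topspace (limit_topology I below X \<phi>) = points (limit_graph I below X \<phi>)"
  using limit_points_subset by (auto simp: limit_topology_def)

lemma inj_alpha: "inj \<alpha>"
  using homeomorphic_imp_injective_map[OF alpha_homeomorphic] by simp

lemma range_alpha: "range \<alpha> = points (limit_graph I below X \<phi>)"
  using homeomorphic_imp_surjective_map[OF alpha_homeomorphic] topspace_limit by simp

lemma alpha_eqI:
  assumes "\<And>i. i \<in> I \<Longrightarrow> \<alpha> x i = \<alpha> y i"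
  shows "x = y"
proof -
  have "\<alpha> x = \<alpha> y"
    using assms by (intro extensionalityI[OF alpha_extensional alpha_extensional]) auto
  then show ?thesis using inj_alpha by (simp add: inj_eq)
qed

text \<open>The limit graph admits only families consisting entirely of vertices or entirely of
  edges. A compatible family cannot mix the two, since transition maps preserve the kind and any two
  indices have a common upper bound.\<close>

lemma limit_point:
  assumes z: "\<And>i. i \<in> I \<Longrightarrow> z i \<in> points (X i)"
    and c: "\<And>i j. i \<in> I \<Longrightarrow> j \<in> I \<Longrightarrow> below i j \<Longrightarrow> \<phi> i j (z j) = z i"
  obtains x where "\<And>i. i \<in> I \<Longrightarrow> \<alpha> x i = z i"
proof -
  have same: "z i \<in> verts (X i) \<longleftrightarrow> z j \<in> verts (X j)" if ij: "i \<in> I" "j \<in> I" for i j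
  proof -
    obtain k where k: "k \<in> I" "below i k" "below j k" using below_upper[OF ij] by blast
    have "z l \<in> verts (X l) \<longleftrightarrow> z k \<in> verts (X k)" if l: "l \<in> I" "below l k" for l
      using graph_map_vert_iff[OF graph_X phi_map z] c l k(1) by metis
    then show ?thesis using ij k by blast
  qed
  have "(\<forall>i\<in>I. z i \<in> verts (X i)) \<or> (\<forall>i\<in>I. z i \<in> edges (X i))"
    using same z unfolding points_def by blast
  then have "(\<lambda>i\<in>I. z i) \<in> points (limit_graph I below X \<phi>)"
    using c unfolding points_def by (auto simp: limit_graph_def)
  then obtain x where "\<alpha> x = (\<lambda>i\<in>I. z i)" using range_alpha by (metis rangeE)
  then have "\<alpha> x i = z i" if "i \<in> I" for i using that by simp
  then show ?thesis using that by blast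
qed

lemma open_alpha_fibre:
  assumes i: "i \<in> I"
  shows "open {x. \<alpha> x i = z}"
proof -
  have "continuous_map euclidean (product_topology (\<lambda>i. discrete_topology (points (X i))) I) \<alpha>"
    using homeomorphic_imp_continuous_map[OF alpha_homeomorphic]
    by (simp add: limit_topology_def continuous_map_in_subtopology)
  then have "continuous_map euclidean (discrete_topology (points (X i))) (\<lambda>x. \<alpha> x i)"
    using i by (auto simp: continuous_map_componentwise)
  then have "openin euclidean {x \<in> topspace euclidean. \<alpha> x i \<in> {z} \<inter> points (X i)}"
    by (rule openin_continuous_map_preimage) simp
  moreover have "{x \<in> topspace euclidean. \<alpha> x i \<in> {z} \<inter> points (X i)} = {x. \<alpha> x i = z}"
    using alpha_points[OF i] by auto
  ultimately show ?thesis by simp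
qed

text \<open>A basic open set of the product restricts finitely many coordinates, and one coordinate
  \<open>k\<close> above all of them determines them through the transition maps.\<close>

lemma alpha_basis:
  assumes U: "open U" "x \<in> U"
  shows "\<exists>i\<in>I. {y. \<alpha> y i = \<alpha> x i} \<subseteq> U"
proof -
  let ?T = "product_topology (\<lambda>i. discrete_topology (points (X i))) I"
  have "openin (limit_topology I below X \<phi>) (\<alpha> ` U)"
    using homeomorphic_imp_open_map[OF alpha_homeomorphic] U by (simp add: open_map_def)
  then obtain W where W: "openin ?T W" "\<alpha> ` U = W \<inter> points (limit_graph I below X \<phi>)"
    by (auto simp: limit_topology_def openin_subtopology)
  have "\<alpha> x \<in> W" using W(2) U by blast
  then obtain V where V: "finite {i \<in> I. V i \<noteq> topspace (discrete_topology (points (X i)))}"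
    "\<alpha> x \<in> Pi\<^sub>E I V" "Pi\<^sub>E I V \<subseteq> W"
    using W(1) unfolding openin_product_topology_alt by blast
  obtain k where k: "k \<in> I" "\<forall>i\<in>{i \<in> I. V i \<noteq> points (X i)}. below i k"
    using directed_index_upper_bound[OF directed V(1)] by auto
  have "y \<in> U" if y: "\<alpha> y k = \<alpha> x k" for y
  proof -
    have "\<alpha> y i \<in> V i" if i: "i \<in> I" for i
    proof (cases "V i = points (X i)")
      case True
      then show ?thesis using alpha_points[OF i] by simp
    next
      case False
      then have "\<alpha> y i = \<alpha> x i" using alpha_below[OF i k(1) _ y] k(2) i by blast
      then show ?thesis using V(2) i by auto
    qed
    then have "\<alpha> y \<in> Pi\<^sub>E I V" using alpha_extensional by (simp add: PiE_def)
    then have "\<alpha> y \<in> \<alpha> ` U" using V(3) W(2) alpha_limit by blast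
    then show ?thesis using inj_alpha by (simp add: inj_image_mem_iff)
  qed
  then show ?thesis using k(1) by blast
qed

text \<open>
  The transition maps need not be surjective, so neither need the projections be.  By compactness
  a point of \<open>X j\<close> that lies in the image of every \<open>X k\<close> comes from the limit.
\<close>

lemma in_range_alpha:
  assumes j: "j \<in> I" and z: "\<And>k. k \<in> I \<Longrightarrow> below j k \<Longrightarrow> z \<in> \<phi> j k ` points (X k)"
  shows "z \<in> range (\<lambda>x. \<alpha> x j)"
proof -
  let ?T = "product_topology (\<lambda>i. discrete_topology (points (X i))) I"
  \<comment> \<open>\<open>C k\<close> imposes compatibility only between \<open>k\<close> and the
    indices below it. These sets are closed, nonempty and decreasing in \<open>k\<close>, and a
    point common to all of them is a compatible family.\<close>
  define C where "C k = {w \<in> topspace ?T. w j = z \<and> (\<forall>i\<in>I. below i k \<longrightarrow> \<phi> i k (w k) = w i)}" for k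
  let ?J = "{k \<in> I. below j k}"
  have comp: "compact_space ?T"
    unfolding compact_space_product_topology
    using finite_points by (simp add: compact_space_discrete_topology)
  have coord: "continuous_map ?T (discrete_topology (points (X i))) (\<lambda>w. w i)" if "i \<in> I" for i
    using continuous_map_product_projection[OF that] .
  have closed: "closedin ?T (C k)" if k: "k \<in> I" for k
  proof -
    have 1: "closedin ?T {w \<in> topspace ?T. w j \<in> {z} \<inter> points (X j)}"
      by (rule closedin_continuous_map_preimage[OF coord[OF j]]) simp
    have 2: "closedin ?T {w \<in> topspace ?T. \<phi> i k (w k) = w i}" if i: "i \<in> I" "below i k" for i
    proof -
      have "continuous_map ?T (prod_topology (discrete_topology (points (X i)))
          (discrete_topology (points (X k)))) (\<lambda>w. (w i, w k))"
        using coord i k by (simp add: continuous_map_pairwise o_def)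
      then have pair: "continuous_map ?T (discrete_topology (points (X i) \<times> points (X k))) (\<lambda>w. (w i, w k))"
        by (simp only: prod_topology_discrete_topology)
      have "closedin ?T {w \<in> topspace ?T. (w i, w k) \<in> {p \<in> points (X i) \<times> points (X k). \<phi> i k (snd p) = fst p}}"
        by (rule closedin_continuous_map_preimage[OF pair]) auto
      moreover have "{w \<in> topspace ?T. (w i, w k) \<in> {p \<in> points (X i) \<times> points (X k). \<phi> i k (snd p) = fst p}}
          = {w \<in> topspace ?T. \<phi> i k (w k) = w i}"
        using i k by (auto simp: PiE_def Pi_def)
      ultimately show ?thesis by simp
    qed
    have "C k = \<Inter>(insert {w \<in> topspace ?T. w j \<in> {z} \<inter> points (X j)}
      ((\<lambda>i. {w \<in> topspace ?T. \<phi> i k (w k) = w i}) ` {i \<in> I. below i k}))"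
      using j unfolding C_def by (auto simp: PiE_def Pi_def)
    then show ?thesis
      using 1 2 by (simp only:) (intro closedin_Inter, blast+)
  qed
  have nonempty: "C k \<noteq> {}" if k: "k \<in> I" "below j k" for k
  proof -
    obtain w where w: "w \<in> points (X k)" "\<phi> j k w = z" using z[OF k] by blast
    have ne: "\<exists>p. p \<in> points (X i)" if "i \<in> I" for i
      using connected[OF that] by (auto simp: path_connected_graph_def)
    \<comment> \<open>The witness is a preimage \<open>w\<close> of \<open>z\<close> at level
      \<open>k\<close>, its images below \<open>k\<close>, and arbitrary points elsewhere.\<close>
    define v where "v = (\<lambda>i\<in>I. if i = k then w else if below i k then \<phi> i k w else SOME p. p \<in> points (X i))"
    have kk: "\<phi> k k w = w"
      using system k w by (auto simp: graph_inverse_system_def)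
    have "v \<in> topspace ?T"
      using graph_map_points[OF phi_map] k w someI_ex[OF ne] by (auto simp: v_def PiE_def)
    then have "v \<in> C k" using k j w kk by (auto simp: C_def v_def)
    then show ?thesis by blast
  qed
  have mono: "C m \<subseteq> C k" if k: "k \<in> I" "m \<in> I" "below k m" for k m
  proof
    fix w assume w: "w \<in> C m"
    have wm: "w m \<in> points (X m)" using w k by (auto simp: C_def)
    have "\<phi> i k (w k) = w i" if i: "i \<in> I" "below i k" for i
    proof -
      have "\<phi> k m (w m) = w k" "\<phi> i m (w m) = w i"
        using w k i below_trans[OF i(1) k(1,2) i(2) k(3)] by (auto simp: C_def)
      then show ?thesis using phi_phi[OF i(1) k(1,2) i(2) k(3) wm] by simp
    qed
    then show "w \<in> C k" using w by (auto simp: C_def)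
  qed
  have "\<Inter>(C ` ?J) \<noteq> {}"
  proof -
    have "\<Inter>\<F> \<noteq> {}" if F: "finite \<F>" "\<F> \<subseteq> C ` ?J" for \<F>
    proof -
      obtain K where K: "finite K" "K \<subseteq> ?J" "\<F> = C ` K" using finite_subset_image[OF F] by blast
      \<comment> \<open>Adding \<open>j\<close> keeps \<open>m\<close> above \<open>j\<close>, so
        that \<open>C m\<close> is nonempty, even when \<open>K\<close> is empty.\<close>
      obtain m where m: "m \<in> I" "\<forall>k\<in>insert j K. below k m"
        using directed_index_upper_bound[OF directed, of "insert j K"] K j by auto
      then have "C m \<subseteq> \<Inter>\<F>" using mono K by blast
      then show ?thesis using nonempty m by blast
    qed
    then show ?thesis
      using comp[unfolded compact_space_fip, rule_format, of "C ` ?J"] closed by blast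
  qed
  then obtain w where w: "w \<in> C k" if "k \<in> ?J" for k by blast
  have "j \<in> ?J" using j below_refl by simp
  then have wT: "w \<in> topspace ?T" "w j = z" using w by (auto simp: C_def)
  have "\<phi> i k (w k) = w i" if ik: "i \<in> I" "k \<in> I" "below i k" for i k
  proof -
    \<comment> \<open>The index \<open>k\<close> need not lie above \<open>j\<close>, so membership
      in \<open>C k\<close> is inherited from \<open>C m\<close> for a common upper bound
      \<open>m\<close>.\<close>
    obtain m where m: "m \<in> I" "below j m" "below k m" using below_upper[OF j ik(2)] by blast
    then have "w \<in> C k" using mono[OF ik(2) m(1,3)] w by blast
    then show ?thesis using ik by (auto simp: C_def)
  qed
  moreover have "w i \<in> points (X i)" if "i \<in> I" for i using wT that by auto
  ultimately obtain x where "\<alpha> x i = w i" if "i \<in> I" for i using limit_point[of w] by metis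
  then have "z = \<alpha> x j" using wT j by simp
  then show ?thesis by blast
qed

text \<open>Each of the finitely many points of \<open>X j\<close> outside the range is missed by
  the image of some later level; an index above these levels misses all of them.\<close>

lemma eventual_image_in_range:
  assumes j: "j \<in> I"
  obtains k where "k \<in> I" "below j k" "\<phi> j k ` points (X k) \<subseteq> range (\<lambda>x. \<alpha> x j)"
proof -
  let ?B = "points (X j) - range (\<lambda>x. \<alpha> x j)"
  have "\<exists>k. k \<in> I \<and> below j k \<and> z \<notin> \<phi> j k ` points (X k)" if "z \<in> ?B" for z
    using in_range_alpha[OF j, of z] that by blast
  then obtain K where K: "K z \<in> I" "below j (K z)" "z \<notin> \<phi> j (K z) ` points (X (K z))"
    if "z \<in> ?B" for z by metis
  have "finite ?B" using finite_points[OF j] by simp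
  then obtain k where k: "k \<in> I" "\<forall>c\<in>insert j (K ` ?B). below c k"
    using directed_index_upper_bound[OF directed, of "insert j (K ` ?B)"] K(1) j by auto
  have "\<phi> j k x \<in> range (\<lambda>x. \<alpha> x j)" if x: "x \<in> points (X k)" for x
  proof (rule ccontr)
    assume n: "\<phi> j k x \<notin> range (\<lambda>x. \<alpha> x j)"
    let ?z = "\<phi> j k x"
    have z: "?z \<in> ?B" using n graph_map_points[OF phi_map[OF j k(1)]] k(2) x by blast
    have b: "below (K ?z) k" using k(2) z by blast
    have "?z = \<phi> j (K ?z) (\<phi> (K ?z) k x)"
      using phi_phi[OF j K(1)[OF z] k(1) K(2)[OF z] b x] by simp
    moreover have "\<phi> (K ?z) k x \<in> points (X (K ?z))"
      using graph_map_points[OF phi_map[OF K(1)[OF z] k(1) b] x] .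
    ultimately show False using K(3)[OF z] by blast
  qed
  then show ?thesis using that k by blast
qed

section \<open>Kernels of the projections and connectedness of the limit\<close>

definition ker :: "'i \<Rightarrow> ('a \<times> 'a) set" where
  "ker i = {(x, y). \<alpha> x i = \<alpha> y i}"

lemma equiv_ker: "equiv UNIV (ker i)"
  by (auto simp: ker_def equiv_def refl_on_def sym_def trans_def)

lemma ker_class: "ker i `` {x} = {y. \<alpha> y i = \<alpha> x i}"
  by (auto simp: ker_def)

lemma ker_antimono: "i \<in> I \<Longrightarrow> j \<in> I \<Longrightarrow> below i j \<Longrightarrow> ker j \<subseteq> ker i"
  unfolding ker_def using alpha_below by blast

text \<open>The kernels form a directed family with open classes, and \<open>alpha_basis\<close>
  says that these classes form a base; compactness does the rest.\<close>

lemma ker_refines: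
  assumes comp: "compact (UNIV :: 'a set)" and E: "equiv UNIV E" "\<And>x. open (E `` {x})"
  shows "\<exists>i\<in>I. ker i \<subseteq> E"
proof -
  have "\<exists>R\<in>ker ` I. R \<subseteq> E"
  proof (rule refine_open_equivalence[OF comp E])
    show "ker ` I \<noteq> {}" using directed by (auto simp: directed_index_def)
    show "\<exists>T\<in>ker ` I. T \<subseteq> R \<inter> S" if RS: "R \<in> ker ` I" "S \<in> ker ` I" for R S
    proof -
      obtain i j where ij: "i \<in> I" "j \<in> I" "R = ker i" "S = ker j" using RS by blast
      then obtain k where "k \<in> I" "below i k" "below j k" using below_upper by blast
      then show ?thesis using ij ker_antimono by blast
    qed
    show "\<exists>R\<in>ker ` I. R `` {x} \<subseteq> U" if "open U" "x \<in> U" for x U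
      using alpha_basis[OF that] by (simp add: ker_class)
  qed (auto simp: equiv_ker ker_class open_alpha_fibre)
  then show ?thesis by blast
qed

text \<open>A clopen \<open>A\<close> is a union of fibres at some level \<open>j\<close>. Since
  \<open>X j\<close> may have points that do not come from \<Gamma>, the trace of \<open>A\<close>
  is pulled back to a level \<open>k\<close> whose image in \<open>X j\<close> consists of points of
  \<Gamma>; there it is incidence closed in a connected graph.\<close>

lemma clopen_incidence_closed_UNIV:
  assumes comp: "compact (UNIV :: 'a set)" and A: "open A" "closed A"
    and inc: "\<And>e. e \<in> edges \<Gamma> \<Longrightarrow> (e \<in> A \<longleftrightarrow> src \<Gamma> e \<in> A) \<and> (e \<in> A \<longleftrightarrow> tgt \<Gamma> e \<in> A)"
    and x: "x \<in> A"
  shows "A = UNIV"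
proof -
  let ?E = "{(x, y). x \<in> A \<longleftrightarrow> y \<in> A}"
  have "?E `` {y} = (if y \<in> A then A else - A)" for y by auto
  then have "open (?E `` {y})" for y using A by (simp add: open_Compl)
  moreover have "equiv UNIV ?E" by (auto simp: equiv_def refl_on_def sym_def trans_def)
  ultimately obtain j where j: "j \<in> I" "ker j \<subseteq> ?E" using ker_refines[OF comp] by metis
  have sat: "\<alpha> y j \<in> (\<lambda>x. \<alpha> x j) ` A \<longleftrightarrow> y \<in> A" for y
    using j(2) by (auto simp: ker_def)
  obtain k where k: "k \<in> I" "below j k" "\<phi> j k ` points (X k) \<subseteq> range (\<lambda>x. \<alpha> x j)"
    using eventual_image_in_range[OF j(1)] .
  note pm = phi_map[OF j(1) k(1,2)]
  have "points (X k) \<subseteq> {w. \<phi> j k w \<in> (\<lambda>x. \<alpha> x j) ` A}"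
  proof (rule path_connected_incidence_closed[OF graph_X[OF k(1)] connected[OF k(1)]])
    show "\<alpha> x k \<in> points (X k)" using alpha_points[OF k(1)] .
    show "\<alpha> x k \<in> {w. \<phi> j k w \<in> (\<lambda>x. \<alpha> x j) ` A}" using alpha_phi[OF j(1) k(1,2)] x by auto
    fix e assume e: "e \<in> edges (X k)"
    \<comment> \<open>The choice of \<open>k\<close> provides an edge \<open>y\<close> of \<Gamma>
      above the image of \<open>e\<close>, to which the hypothesis on \<open>A\<close>
      applies.\<close>
    then obtain y where y: "\<phi> j k e = \<alpha> y j" using k(3) by (auto simp: points_def)
    have "\<alpha> y j \<in> edges (X j)" using y graph_map_edges[OF pm e] by simp
    then have "y \<in> edges \<Gamma>"
      using graph_map_edge_iff[OF graph_X alpha_map] j(1) points_\<Gamma> by blast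
    then show "(e \<in> {w. \<phi> j k w \<in> (\<lambda>x. \<alpha> x j) ` A} \<longleftrightarrow> src (X k) e \<in> {w. \<phi> j k w \<in> (\<lambda>x. \<alpha> x j) ` A}) \<and>
      (e \<in> {w. \<phi> j k w \<in> (\<lambda>x. \<alpha> x j) ` A} \<longleftrightarrow> tgt (X k) e \<in> {w. \<phi> j k w \<in> (\<lambda>x. \<alpha> x j) ` A})"
      using inc[of y] graph_map_incidence[OF pm e] graph_map_incidence[OF alpha_map[OF j(1)], of y] y
        sat[of y] sat[of "src \<Gamma> y"] sat[of "tgt \<Gamma> y"] by auto
  qed
  then have "y \<in> A" for y
    using alpha_points[OF k(1), of y] alpha_phi[OF j(1) k(1,2), of y] sat[of y]
    by (metis (mono_tags, lifting) mem_Collect_eq subsetD)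
  then show ?thesis by blast
qed

lemma compatible_ker:
  assumes i: "i \<in> I"
  shows "compatible \<Gamma> (ker i)"
proof -
  note am = alpha_map[OF i]
  have "(v, e) \<notin> ker i" if "v \<in> verts \<Gamma>" "e \<in> edges \<Gamma>" for v e
    using graph_map_verts[OF am] graph_map_edges[OF am] that graph_X[OF i]
    by (fastforce simp: ker_def is_graph_def)
  moreover have "(e, einv \<Gamma> e) \<notin> ker i" if "e \<in> edges \<Gamma>" for e
    using graph_map_incidence(3)[OF am that] graph_edge(5)[OF graph_X[OF i] graph_map_edges[OF am that]]
    by (simp add: ker_def)
  ultimately show ?thesis
    unfolding compatible_def points_\<Gamma>
    using equiv_ker graph_map_incidence[OF am] by (auto simp: ker_def)
qed

lemma finite_quotient_ker:
  assumes i: "i \<in> I"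
  shows "finite (points \<Gamma> // ker i)"
proof -
  have "points \<Gamma> // ker i \<subseteq> (\<lambda>z. {y. \<alpha> y i = z}) ` points (X i)"
    using alpha_points[OF i] by (auto simp: quotient_def ker_class)
  then show ?thesis using finite_points[OF i] by (meson finite_imageI finite_subset)
qed

end

section \<open>Passing between the topology and the uniformity\<close>

lemma open_equivalence_class:
  fixes R :: "('a::uniform_space \<times> 'a) set"
  assumes "entourage R" "equiv UNIV R"
  shows "open (R `` {x})"
  unfolding open_uniformity
proof
  fix y assume "y \<in> R `` {x}"
  then have "(x, y) \<in> R" by simp
  then have "(x', z) \<in> R \<Longrightarrow> x' = y \<longrightarrow> z \<in> R `` {x}" for x' z
    using assms(2) by (auto elim: equivE dest: transD)
  then show "\<forall>\<^sub>F (x', z) in uniformity. x' = y \<longrightarrow> z \<in> R `` {x}"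
    using assms(1) unfolding entourage_def by (auto elim!: eventually_mono)
qed

text \<open>A limit presentation controls only the topology. Compactness recovers the uniformity:
  the compatible cofinite entourages refine every equivalence relation with open classes.\<close>

lemma open_equivalence_entourage:
  fixes E :: "('a::{t2_space,uniform_space} \<times> 'a) set"
  assumes \<Gamma>: "profinite_graph (\<Gamma> :: 'a pre_graph)" and E: "equiv UNIV E" "\<And>x. open (E `` {x})"
  shows "entourage E"
proof -
  have c: "compact (UNIV :: 'a set)" "points \<Gamma> = UNIV"
    "\<And>S. entourage S \<Longrightarrow> \<exists>R\<subseteq>S. compatible_cofinite_entourage \<Gamma> R"
    using \<Gamma> by (auto simp: profinite_graph_def cofinite_graph_def)
  let ?F = "{R. compatible_cofinite_entourage \<Gamma> R}"
  have eq: "equiv UNIV R" "entourage R" if "R \<in> ?F" for R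
    using that c(2) by (auto simp: compatible_cofinite_entourage_def compatible_def)
  have "\<exists>R\<in>?F. R \<subseteq> E"
  proof (rule refine_open_equivalence[OF c(1) E])
    show "open (R `` {x})" if "R \<in> ?F" for R x
      using open_equivalence_class eq that by blast
    have "entourage (UNIV :: ('a \<times> 'a) set)" by (simp add: entourage_def)
    then show "?F \<noteq> {}" using c(3) by blast
    show "\<exists>T\<in>?F. T \<subseteq> R \<inter> S" if "R \<in> ?F" "S \<in> ?F" for R S
    proof -
      have "entourage (R \<inter> S)"
        using eq(2)[OF that(1)] eq(2)[OF that(2)] by (simp add: entourage_def eventually_conj_iff)
      then show ?thesis using c(3) by blast
    qed
    show "\<exists>R\<in>?F. R `` {x} \<subseteq> U" if U: "open U" "x \<in> U" for x :: 'a and U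
    proof -
      \<comment> \<open>This entourage constrains only the pairs starting at \<open>x\<close>, so
        the class of \<open>x\<close> under any refinement lies in \<open>U\<close>.\<close>
      have "entourage {(x', y). x' = x \<longrightarrow> y \<in> U}"
        using U unfolding open_uniformity entourage_def by (simp add: case_prod_unfold)
      then obtain R where "R \<subseteq> {(x', y). x' = x \<longrightarrow> y \<in> U}" "R \<in> ?F" using c(3) by blast
      then show ?thesis by blast
    qed
  qed (use eq in auto)
  then obtain R where "entourage R" "R \<subseteq> E" using eq by blast
  then show ?thesis unfolding entourage_def by (auto elim!: eventually_mono)
qed

section \<open>Covering transformations of a limit of regular coverings\<close>

locale regular_covering_limit =
  graph_limit I below X \<phi> \<Gamma> \<alpha> + target: graph_limit I below Y \<psi> \<Delta> \<beta>
  for I :: "'i set" and below :: "'i \<Rightarrow> 'i \<Rightarrow> bool"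
    and X :: "'i \<Rightarrow> 'c pre_graph" and \<phi> :: "'i \<Rightarrow> 'i \<Rightarrow> 'c \<Rightarrow> 'c"
    and \<Gamma> :: "'a::{t2_space,uniform_space} pre_graph" and \<alpha> :: "'a \<Rightarrow> 'i \<Rightarrow> 'c"
    and Y :: "'i \<Rightarrow> 'd pre_graph" and \<psi> :: "'i \<Rightarrow> 'i \<Rightarrow> 'd \<Rightarrow> 'd"
    and \<Delta> :: "'b::{t2_space,uniform_space} pre_graph" and \<beta> :: "'b \<Rightarrow> 'i \<Rightarrow> 'd" +
  fixes q :: "'i \<Rightarrow> 'c \<Rightarrow> 'd" and f :: "'a \<Rightarrow> 'b"
  assumes profinite: "profinite_graph \<Gamma>"
    and f_map: "graph_map \<Gamma> \<Delta> f" and f_continuous: "continuous_on UNIV f"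
    and covering: "i \<in> I \<Longrightarrow> regular_covering_map (X i) (Y i) (q i)"
    and q_phi: "i \<in> I \<Longrightarrow> j \<in> I \<Longrightarrow> below i j \<Longrightarrow> z \<in> points (X j) \<Longrightarrow> q i (\<phi> i j z) = \<psi> i j (q j z)"
    and beta_f: "i \<in> I \<Longrightarrow> \<beta> (f x) i = q i (\<alpha> x i)"
begin

lemma compact_\<Gamma>: "compact (UNIV :: 'a set)"
  using profinite by (simp add: profinite_graph_def)

lemma covering_map: "i \<in> I \<Longrightarrow> covering_map (X i) (Y i) (q i)"
  using covering by (simp add: regular_covering_map_def)

lemma ex_vertex: "\<exists>x. x \<in> verts \<Gamma>"
  using points_\<Gamma> graph_edge(1)[OF graph_\<Gamma>] unfolding points_def by blast

lemma q_alpha_eq: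
  assumes i: "i \<in> I" and "f x = f y"
  shows "q i (\<alpha> x i) = q i (\<alpha> y i)"
  using beta_f[OF i] assms(2) by metis

text \<open>The agreement set of two locally constant lifts is clopen, and it is incidence closed
  because \<open>q i\<close> is locally bijective; connectedness of \<Gamma> makes it
  everything.\<close>

lemma limit_lifts_eq:
  assumes i: "i \<in> I" and u: "graph_map \<Gamma> (X i) u" and w: "graph_map \<Gamma> (X i) w"
    and lc: "\<And>z. open {x. u x = z}" "\<And>z. open {x. w x = z}"
    and q: "\<And>x. q i (u x) = q i (w x)" and x: "u x = w x"
  shows "u y = w y"
proof -
  have "{y. u y = w y} = UNIV"
  proof (rule clopen_incidence_closed_UNIV[OF compact_\<Gamma>])
    have "{y. u y = w y} = (\<Union>z. {y. u y = z} \<inter> {y. w y = z})" by auto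
    also have "open \<dots>" by (intro open_UN ballI open_Int lc)
    finally show "open {y. u y = w y}" .
    have "- {y. u y = w y} = (\<Union>z. \<Union>z'\<in>- {z}. {y. u y = z} \<inter> {y. w y = z'})" by auto
    also have "open \<dots>" by (intro open_UN ballI open_Int lc)
    finally show "closed {y. u y = w y}" by (simp add: closed_def)
    show "x \<in> {y. u y = w y}" using x by simp
  qed (use covering_map.lifts_agree_incidence[OF covering_map[OF i] graph_\<Gamma> u w _ q] in blast)
  then show ?thesis by blast
qed

text \<open>Invertibility is deferred: rigidity already holds for endomorphisms, and it later makes
  an endomorphism carrying \<open>x\<close> to \<open>y\<close> and one carrying \<open>y\<close> to
  \<open>x\<close> mutually inverse.\<close>

definition covering_endo :: "('a \<Rightarrow> 'a) \<Rightarrow> bool" where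
  "covering_endo g \<longleftrightarrow> graph_map \<Gamma> \<Gamma> g \<and> continuous_on UNIV g \<and> (\<forall>x. f (g x) = f x)"

lemma covering_endo_id: "covering_endo (\<lambda>x. x)"
  by (simp add: covering_endo_def graph_map_id)

lemma covering_endo_comp: "covering_endo g \<Longrightarrow> covering_endo h \<Longrightarrow> covering_endo (\<lambda>x. g (h x))"
  unfolding covering_endo_def
  by (auto intro: graph_map_comp continuous_on_compose2)

lemma covering_endo_fibre_open:
  assumes "covering_endo g" "i \<in> I"
  shows "open {x. \<alpha> (g x) i = z}"
proof -
  have "open (g -` {x. \<alpha> x i = z})"
    using assms open_alpha_fibre by (intro open_vimage) (auto simp: covering_endo_def)
  then show ?thesis by (simp add: vimage_def)
qed

text \<open>Rigidity at level \<open>i\<close>: both composites with the projection are lifts of the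
  same map from \<Gamma> to \<open>Y i\<close>, so one common value suffices.\<close>

lemma covering_endo_agree:
  assumes g: "covering_endo g" and h: "covering_endo h" and i: "i \<in> I"
    and x: "\<alpha> (g x) i = \<alpha> (h x) i"
  shows "\<alpha> (g y) i = \<alpha> (h y) i"
proof (rule limit_lifts_eq[OF i, where u = "\<lambda>x. \<alpha> (g x) i" and w = "\<lambda>x. \<alpha> (h x) i"])
  show "graph_map \<Gamma> (X i) (\<lambda>x. \<alpha> (g x) i)" "graph_map \<Gamma> (X i) (\<lambda>x. \<alpha> (h x) i)"
    using g h by (auto simp: covering_endo_def intro: graph_map_comp[OF alpha_map[OF i]])
  show "q i (\<alpha> (g y) i) = q i (\<alpha> (h y) i)" for y
    using g h by (intro q_alpha_eq[OF i]) (simp add: covering_endo_def)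
qed (use covering_endo_fibre_open[OF _ i] g h x in auto)

lemma covering_endo_eqI:
  assumes "covering_endo g" "covering_endo h" "g x = h x"
  shows "g y = h y"
  using covering_endo_agree[OF assms(1,2)] assms(3) by (intro alpha_eqI) metis

text \<open>
  Every covering endomorphism of the limit induces a deck transformation of each \<open>X i\<close>: the two
  lifts \<open>x \<mapsto> \<alpha> (g x) i\<close> and \<open>x \<mapsto> h (\<alpha> x i)\<close> agree at one vertex.
\<close>

lemma covering_endo_ker:
  assumes g: "covering_endo g" and i: "i \<in> I" and xy: "\<alpha> x i = \<alpha> y i"
  shows "\<alpha> (g x) i = \<alpha> (g y) i"
proof -
  obtain v where v: "v \<in> verts \<Gamma>" using ex_vertex by blast
  have gv: "g v \<in> verts \<Gamma>" using g v graph_map_verts by (auto simp: covering_endo_def)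
  have qg: "q i (\<alpha> z i) = q i (\<alpha> (g z) i)" for z
    using g by (intro q_alpha_eq[OF i]) (simp add: covering_endo_def)
  obtain h where h: "graph_map (X i) (X i) h" "\<And>z. z \<in> points (X i) \<Longrightarrow> q i (h z) = q i z"
    "h (\<alpha> v i) = \<alpha> (g v) i"
    using regular_covering_map.deck_transformation[OF covering[OF i]
        graph_map_verts[OF alpha_map[OF i] v] graph_map_verts[OF alpha_map[OF i] gv] qg] by blast
  have "\<alpha> (g z) i = h (\<alpha> z i)" for z
  proof (rule limit_lifts_eq[OF i, where u = "\<lambda>x. \<alpha> (g x) i" and w = "\<lambda>x. h (\<alpha> x i)"])
    show "graph_map \<Gamma> (X i) (\<lambda>x. \<alpha> (g x) i)"
      using g by (auto simp: covering_endo_def intro: graph_map_comp[OF alpha_map[OF i]])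
    show "graph_map \<Gamma> (X i) (\<lambda>x. h (\<alpha> x i))"
      using graph_map_comp[OF h(1) alpha_map[OF i]] .
    show "open {x. \<alpha> (g x) i = z}" for z using covering_endo_fibre_open[OF g i] .
    have "{x. h (\<alpha> x i) = z} = (\<Union>z'\<in>{z'. h z' = z}. {x. \<alpha> x i = z'})" for z by auto
    then show "open {x. h (\<alpha> x i) = z}" for z using open_alpha_fibre[OF i] by auto
    show "q i (\<alpha> (g z) i) = q i (h (\<alpha> z i))" for z
      using qg h(2)[OF alpha_points[OF i]] by simp
    show "\<alpha> (g v) i = h (\<alpha> v i)" using h(3) by simp
  qed
  then show ?thesis using xy by simp
qed

text \<open>Deck transformations \<open>h i\<close> carrying \<open>\<alpha> x i\<close> to
  \<open>\<alpha> y i\<close> exist at every level; uniqueness of lifts makes them compatible, so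
  they define a map of the limit.\<close>

lemma covering_endo_transitive:
  assumes x: "x \<in> verts \<Gamma>" and y: "y \<in> verts \<Gamma>" and xy: "f x = f y"
  obtains g where "covering_endo g" "g x = y"
proof -
  have "\<exists>h. graph_map (X i) (X i) h \<and> (\<forall>z\<in>points (X i). q i (h z) = q i z) \<and> h (\<alpha> x i) = \<alpha> y i"
    if i: "i \<in> I" for i
    using regular_covering_map.deck_transformation[OF covering[OF i]
        graph_map_verts[OF alpha_map[OF i] x] graph_map_verts[OF alpha_map[OF i] y] q_alpha_eq[OF i xy]]
    by metis
  then obtain h where h: "graph_map (X i) (X i) (h i)" "z \<in> points (X i) \<Longrightarrow> q i (h i z) = q i z"
    "h i (\<alpha> x i) = \<alpha> y i" if "i \<in> I" for i z by metis
  \<comment> \<open>Both composites are lifts of the same map on the connected graph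
    \<open>X j\<close>, and they agree at \<open>\<alpha> x j\<close>.\<close>
  have comm: "\<phi> i j (h j z) = h i (\<phi> i j z)" if ij: "i \<in> I" "j \<in> I" "below i j" and z: "z \<in> points (X j)"
    for i j z
  proof (rule covering_map.lifts_eq[OF covering_map[OF ij(1)] graph_X[OF ij(2)] connected[OF ij(2)],
        where u = "\<lambda>z. \<phi> i j (h j z)" and w = "\<lambda>z. h i (\<phi> i j z)"])
    show "graph_map (X j) (X i) (\<lambda>z. \<phi> i j (h j z))" "graph_map (X j) (X i) (\<lambda>z. h i (\<phi> i j z))"
      using ij by (auto intro: graph_map_comp phi_map h(1))
    show "q i (\<phi> i j (h j z)) = q i (h i (\<phi> i j z))" if z: "z \<in> points (X j)" for z
      using q_phi[OF ij] h(2)[OF ij(2) z] h(2)[OF ij(1) graph_map_points[OF phi_map[OF ij] z]]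
        graph_map_points[OF h(1)[OF ij(2)] z] z by simp
    show "\<alpha> x j \<in> points (X j)" using alpha_points[OF ij(2)] .
    show "\<phi> i j (h j (\<alpha> x j)) = h i (\<phi> i j (\<alpha> x j))"
      using h(3) alpha_phi ij by simp
  qed (rule z)
  have "\<exists>v. \<forall>i\<in>I. \<alpha> v i = h i (\<alpha> w i)" for w
  proof -
    obtain v where "\<And>i. i \<in> I \<Longrightarrow> \<alpha> v i = h i (\<alpha> w i)"
    proof (rule limit_point)
      show "h i (\<alpha> w i) \<in> points (X i)" if "i \<in> I" for i
        using graph_map_points[OF h(1) alpha_points] that by blast
      show "\<phi> i j (h j (\<alpha> w j)) = h i (\<alpha> w i)" if "i \<in> I" "j \<in> I" "below i j" for i j
        using comm[OF that alpha_points] alpha_phi[OF that] that by simp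
    qed blast
    then show ?thesis by blast
  qed
  then obtain g where g: "\<alpha> (g w) i = h i (\<alpha> w i)" if "i \<in> I" for i w by metis
  obtain i\<^sub>0 where i0: "i\<^sub>0 \<in> I" using directed by (auto simp: directed_index_def)
  have all: "w \<in> points \<Gamma>" for w using points_\<Gamma> by simp
  \<comment> \<open>Whether a point is a vertex or an edge can be read off at the single level
    \<open>i\<^sub>0\<close>.\<close>
  have gV: "g w \<in> verts \<Gamma> \<longleftrightarrow> w \<in> verts \<Gamma>" and gE: "g w \<in> edges \<Gamma> \<longleftrightarrow> w \<in> edges \<Gamma>" for w
    using graph_map_vert_iff[OF graph_X[OF i0] alpha_map[OF i0] all]
      graph_map_edge_iff[OF graph_X[OF i0] alpha_map[OF i0] all]
      graph_map_vert_iff[OF graph_X[OF i0] h(1)[OF i0] alpha_points[OF i0]]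
      graph_map_edge_iff[OF graph_X[OF i0] h(1)[OF i0] alpha_points[OF i0]] g[OF i0] by metis+
  have "g (src \<Gamma> e) = src \<Gamma> (g e) \<and> g (tgt \<Gamma> e) = tgt \<Gamma> (g e) \<and> g (einv \<Gamma> e) = einv \<Gamma> (g e)"
    if e: "e \<in> edges \<Gamma>" for e
  proof -
    have ge: "g e \<in> edges \<Gamma>" using e gE by simp
    have "\<alpha> (g (src \<Gamma> e)) i = \<alpha> (src \<Gamma> (g e)) i" "\<alpha> (g (tgt \<Gamma> e)) i = \<alpha> (tgt \<Gamma> (g e)) i"
      "\<alpha> (g (einv \<Gamma> e)) i = \<alpha> (einv \<Gamma> (g e)) i" if i: "i \<in> I" for i
      using graph_map_incidence[OF alpha_map[OF i] e] graph_map_incidence[OF alpha_map[OF i] ge]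
        graph_map_incidence[OF h(1)[OF i] graph_map_edges[OF alpha_map[OF i] e]] g[OF i] by simp_all
    then show ?thesis by (auto intro: alpha_eqI)
  qed
  then have "graph_map \<Gamma> \<Gamma> g" unfolding graph_map_def using gV gE by auto
  moreover have "continuous_on UNIV g"
    unfolding continuous_on_open_vimage[OF open_UNIV]
  proof (intro allI impI)
    fix U :: "'a set" assume U: "open U"
    have "\<exists>T. open T \<and> w \<in> T \<and> T \<subseteq> g -` U" if w: "w \<in> g -` U" for w
    proof -
      obtain i where i: "i \<in> I" "{y. \<alpha> y i = \<alpha> (g w) i} \<subseteq> U"
        using alpha_basis[OF U, of "g w"] w by auto
      \<comment> \<open>Coordinate \<open>i\<close> of \<open>g y\<close> depends only on coordinate
        \<open>i\<close> of \<open>y\<close>, which gives continuity.\<close>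
      have "\<alpha> (g y) i = \<alpha> (g w) i" if "\<alpha> y i = \<alpha> w i" for y using g[OF i(1)] that by simp
      then have "{y. \<alpha> y i = \<alpha> w i} \<subseteq> g -` U" using i(2) by blast
      then show ?thesis using open_alpha_fibre[OF i(1), of "\<alpha> w i"] by blast
    qed
    then show "open (g -` U \<inter> UNIV)" by (subst open_subopen) auto
  qed
  moreover have "f (g w) = f w" for w
    using beta_f g h(2)[OF _ alpha_points] by (intro target.alpha_eqI) simp
  ultimately have "covering_endo g" by (simp add: covering_endo_def)
  moreover have "g x = y" using g h(3) by (intro alpha_eqI) simp
  ultimately show ?thesis using that by blast
qed

section \<open>The group of covering transformations and its transitivity\<close>

abbreviation G :: "('a \<Rightarrow> 'a) monoid" where "G \<equiv> Aut \<Gamma> f"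

text \<open>The inverse homeomorphism is again a graph map over \<Delta>: its incidence relations
  follow by applying those of \<open>g\<close> and cancelling. Hence rigidity applies to inverses as
  well.\<close>

lemma Aut_iff:
  "g \<in> carrier G \<longleftrightarrow> covering_endo g \<and>
     (\<exists>k. covering_endo k \<and> (\<forall>x. g (k x) = x) \<and> (\<forall>x. k (g x) = x))"
proof
  assume g: "g \<in> carrier G"
  then obtain k where k: "graph_map \<Gamma> \<Gamma> g" "f \<circ> g = f" "homeomorphism UNIV UNIV g k"
    by (auto simp: Aut_def)
  have gk: "g (k x) = x" "k (g x) = x" and c: "continuous_on UNIV g" "continuous_on UNIV k" for x
    using k(3) by (auto simp: homeomorphism_def)
  have f: "f (g x) = f x" for x using k(2) by (metis comp_apply)
  have kV: "k x \<in> verts \<Gamma>" if "x \<in> verts \<Gamma>" for x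
    using graph_map_vert_iff[OF graph_\<Gamma> k(1), of "k x"] gk points_\<Gamma> that by simp
  have kE: "k x \<in> edges \<Gamma>" if "x \<in> edges \<Gamma>" for x
    using graph_map_edge_iff[OF graph_\<Gamma> k(1), of "k x"] gk points_\<Gamma> that by simp
  have "k (src \<Gamma> e) = src \<Gamma> (k e) \<and> k (tgt \<Gamma> e) = tgt \<Gamma> (k e) \<and> k (einv \<Gamma> e) = einv \<Gamma> (k e)"
    if "e \<in> edges \<Gamma>" for e
    using graph_map_incidence[OF k(1) kE[OF that]] gk by metis
  then have "graph_map \<Gamma> \<Gamma> k" using kV kE by (auto simp: graph_map_def)
  moreover have "f (k x) = f x" for x using f[of "k x"] gk by simp
  ultimately show "covering_endo g \<and> (\<exists>k. covering_endo k \<and> (\<forall>x. g (k x) = x) \<and> (\<forall>x. k (g x) = x))"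
    using k(1) f c gk unfolding covering_endo_def by blast
next
  assume "covering_endo g \<and> (\<exists>k. covering_endo k \<and> (\<forall>x. g (k x) = x) \<and> (\<forall>x. k (g x) = x))"
  then obtain k where g: "covering_endo g" and k: "covering_endo k" "\<And>x. g (k x) = x" "\<And>x. k (g x) = x"
    by blast
  have "homeomorphism UNIV UNIV g k"
    using g k by (intro homeomorphismI) (auto simp: covering_endo_def)
  then show "g \<in> carrier G" using g by (auto simp: Aut_def covering_endo_def fun_eq_iff)
qed

lemma Aut_endo: "g \<in> carrier G \<Longrightarrow> covering_endo g"
  by (simp add: Aut_iff)

lemma Aut_mult: "g \<otimes>\<^bsub>G\<^esub> h = (\<lambda>x. g (h x))"
  and Aut_one: "\<one>\<^bsub>G\<^esub> = (\<lambda>x. x)"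
  by (auto simp: Aut_def)

lemma group_Aut: "group G"
proof (rule groupI)
  show "g \<otimes>\<^bsub>G\<^esub> h \<in> carrier G" if gh: "g \<in> carrier G" "h \<in> carrier G" for g h
  proof -
    obtain g' h' where inv: "covering_endo g'" "\<forall>x. g (g' x) = x" "\<forall>x. g' (g x) = x"
      "covering_endo h'" "\<forall>x. h (h' x) = x" "\<forall>x. h' (h x) = x"
      using gh unfolding Aut_iff by blast
    have "covering_endo (\<lambda>x. g (h x))" "covering_endo (\<lambda>x. h' (g' x))"
      using gh inv(1,4) by (simp_all add: Aut_iff covering_endo_comp)
    moreover have "g (h (h' (g' x))) = x" "h' (g' (g (h x))) = x" for x
      using inv by simp_all
    ultimately show ?thesis
      unfolding Aut_mult Aut_iff by (intro conjI exI[of _ "\<lambda>x. h' (g' x)"]) auto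
  qed
  show "\<one>\<^bsub>G\<^esub> \<in> carrier G"
    unfolding Aut_one Aut_iff using covering_endo_id by auto
  show "\<exists>h\<in>carrier G. h \<otimes>\<^bsub>G\<^esub> g = \<one>\<^bsub>G\<^esub>" if g: "g \<in> carrier G" for g
  proof -
    obtain k where "covering_endo k" "\<forall>x. g (k x) = x" "\<forall>x. k (g x) = x"
      using g by (auto simp: Aut_iff)
    then show ?thesis
      unfolding Aut_mult Aut_one using g by (intro bexI[of _ k]) (auto simp: Aut_iff)
  qed
qed (auto simp: Aut_mult Aut_one)

sublocale G: group G by (rule group_Aut)

lemma Aut_inv:
  assumes "g \<in> carrier G"
  shows "g ((inv\<^bsub>G\<^esub> g) x) = x" "(inv\<^bsub>G\<^esub> g) (g x) = x"
  using G.r_inv[OF assms] G.l_inv[OF assms] unfolding Aut_mult Aut_one by metis+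

text \<open>\<open>covering_endo_ker\<close> is applied to \<open>g\<close> and to its
  inverse.\<close>

lemma Aut_ker:
  assumes g: "g \<in> carrier G" and i: "i \<in> I"
  shows "\<alpha> (g x) i = \<alpha> (g y) i \<longleftrightarrow> \<alpha> x i = \<alpha> y i"
  using covering_endo_ker[OF Aut_endo[OF g] i, of x y]
    covering_endo_ker[OF Aut_endo[OF G.inv_closed[OF g]] i, of "g x" "g y"] Aut_inv[OF g] by metis

text \<open>Endomorphisms carrying \<open>x\<close> to \<open>y\<close> and back have composites
  that fix a point, so by rigidity both composites are the identity.\<close>

lemma Aut_transitive:
  assumes x: "x \<in> verts \<Gamma>" and y: "y \<in> verts \<Gamma>" and xy: "f x = f y"
  shows "\<exists>g\<in>carrier G. g x = y"
proof -
  obtain g where g: "covering_endo g" "g x = y" using covering_endo_transitive[OF assms] .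
  obtain k where k: "covering_endo k" "k y = x"
    using covering_endo_transitive[OF y x xy[symmetric]] .
  have "g (k z) = z" "k (g z) = z" for z
    using covering_endo_eqI[OF covering_endo_comp[OF g(1) k(1)] covering_endo_id, of y z]
      covering_endo_eqI[OF covering_endo_comp[OF k(1) g(1)] covering_endo_id, of x z] g k by simp_all
  then show ?thesis using g k by (intro bexI[of _ g]) (auto simp: Aut_iff)
qed

text \<open>Points above a vertex are vertices, so transitivity applies to the whole fibre;
  uniqueness is rigidity.\<close>

lemma Aut_simply_transitive:
  assumes b: "b \<in> verts \<Delta>"
  shows "simply_transitive_on G (\<lambda>h. h) (f -` {b})"
proof -
  have V: "x \<in> verts \<Gamma>" if "f x = b" for x
    using graph_map_vert_iff[OF target.graph_\<Gamma> f_map, of x] that b points_\<Gamma> by simp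
  have "\<exists>!g. g \<in> carrier G \<and> g x = y" if xy: "f x = b" "f y = b" for x y
  proof (rule ex_ex1I)
    show "\<exists>g. g \<in> carrier G \<and> g x = y" using Aut_transitive[of x y] V xy by auto
    show "g = h" if "g \<in> carrier G \<and> g x = y" "h \<in> carrier G \<and> h x = y" for g h
      using covering_endo_eqI[OF Aut_endo Aut_endo, of g h x] that by (intro ext) simp
  qed
  then show ?thesis
    unfolding simply_transitive_on_def using Aut_endo by (auto simp: covering_endo_def)
qed

lemma graph_action_Aut: "graph_action G \<Gamma> (\<lambda>h. h)"
proof -
  have "bij g" if "g \<in> carrier G" for g
    using Aut_inv[OF that] by (intro bijI') metis+
  then have "group_action G UNIV (\<lambda>h. h)"
    by (intro group_action.intro)
      (auto simp: group_hom_def group_hom_axioms_def group_Aut group_BijGroup hom_def,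
        auto simp: BijGroup_def Bij_def compose_def Aut_mult)
  then show ?thesis
    using Aut_endo by (auto simp: graph_action_def points_\<Gamma> covering_endo_def)
qed

section \<open>Invariant entourages and residual freeness\<close>

lemma entourage_ker: "i \<in> I \<Longrightarrow> entourage (ker i)"
  using open_equivalence_entourage[OF profinite equiv_ker] open_alpha_fibre by (simp add: ker_class)

lemma invariant_ker:
  assumes i: "i \<in> I"
  shows "invariant_entourage G \<Gamma> (\<lambda>h. h) (ker i)"
proof -
  have "map_prod g g ` ker i = ker i" if g: "g \<in> carrier G" for g
  proof (intro equalityI subsetI)
    fix p assume p: "p \<in> ker i"
    obtain x y where xy: "p = (x, y)" by (cases p)
    have "((inv\<^bsub>G\<^esub> g) x, (inv\<^bsub>G\<^esub> g) y) \<in> ker i"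
      using p xy Aut_ker[OF G.inv_closed[OF g] i] by (simp add: ker_def)
    moreover have "p = map_prod g g ((inv\<^bsub>G\<^esub> g) x, (inv\<^bsub>G\<^esub> g) y)"
      using Aut_inv[OF g] xy by simp
    ultimately show "p \<in> map_prod g g ` ker i" by (rule image_eqI[rotated])
  qed (use Aut_ker[OF g i] in \<open>auto simp: ker_def\<close>)
  then show ?thesis
    using i by (simp add: invariant_entourage_def compatible_cofinite_entourage_def
        entourage_ker compatible_ker finite_quotient_ker)
qed

text \<open>A compatible cofinite entourage has open classes, so some kernel refines it.\<close>

lemma entourage_contains_ker:
  assumes S: "entourage S"
  shows "\<exists>i\<in>I. ker i \<subseteq> S"
proof -
  obtain R where R: "R \<subseteq> S" "compatible_cofinite_entourage \<Gamma> R"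
    using profinite S by (auto simp: profinite_graph_def cofinite_graph_def)
  then have "entourage R" "equiv UNIV R"
    by (auto simp: compatible_cofinite_entourage_def compatible_def points_\<Gamma>)
  then show ?thesis using ker_refines[OF compact_\<Gamma>, of R] open_equivalence_class R(1) by blast
qed

lemma action_kernel_ker:
  "action_kernel G \<Gamma> (\<lambda>h. h) (ker i) = {g \<in> carrier G. \<forall>x. \<alpha> (g x) i = \<alpha> x i}"
  by (auto simp: action_kernel_def ker_def points_\<Gamma>)

text \<open>If a coset fixes the class of \<open>x\<close>, its representative agrees with the
  identity at \<open>x\<close> modulo level \<open>i\<close>, hence everywhere by rigidity, so the
  coset is trivial.\<close>

lemma residually_free_Aut: "residually_free G \<Gamma> (\<lambda>h. h)"
proof -
  have "fundamental_system (ker ` I)"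
    using entourage_ker entourage_contains_ker by (auto simp: fundamental_system_def)
  moreover have "C = N"
    if i: "i \<in> I" and N: "N = action_kernel G \<Gamma> (\<lambda>h. h) (ker i)"
      and C: "C \<in> rcosets\<^bsub>G\<^esub> N" and P: "P \<in> points \<Gamma> // ker i"
      and fix_P: "quotient_act (\<lambda>h. h) (ker i) C P = P" for i N C P
  proof -
    have sub: "subgroup N G"
    proof (rule G.subgroupI)
      show "N \<subseteq> carrier G" by (auto simp: N action_kernel_ker)
      show "N \<noteq> {}" using G.one_closed by (auto simp: N action_kernel_ker Aut_one)
      show "inv\<^bsub>G\<^esub> g \<in> N" if "g \<in> N" for g
      proof -
        have g: "g \<in> carrier G" "\<And>x. \<alpha> (g x) i = \<alpha> x i"
          using that by (auto simp: N action_kernel_ker)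
        have "\<alpha> ((inv\<^bsub>G\<^esub> g) x) i = \<alpha> x i" for x
          using g(2)[of "(inv\<^bsub>G\<^esub> g) x"] Aut_inv[OF g(1)] by simp
        then show ?thesis using g by (simp add: N action_kernel_ker)
      qed
      show "g \<otimes>\<^bsub>G\<^esub> h \<in> N" if "g \<in> N" "h \<in> N" for g h
        using that G.m_closed[of g h] by (auto simp: N action_kernel_ker Aut_mult)
    qed
    obtain x where x: "P = ker i `` {x}" using P by (auto simp: quotient_def)
    obtain g where g: "g \<in> carrier G" "C = N #>\<^bsub>G\<^esub> g" using C by (auto simp: RCOSETS_def)
    \<comment> \<open>\<open>quotient_act\<close> is a union over all representatives, so it
      contains \<open>g x\<close> for the chosen \<open>g\<close> and \<open>x\<close>.\<close>
    have "g \<in> C" using G.rcos_self[OF g(1) sub] g(2) by simp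
    moreover have "x \<in> P" using x by (simp add: ker_class)
    moreover have "g x \<in> ker i `` {g x}" by (simp add: ker_class)
    ultimately have "g x \<in> quotient_act (\<lambda>h. h) (ker i) C P"
      unfolding quotient_act_def by blast
    then have "\<alpha> (g x) i = \<alpha> x i" using fix_P x by (simp add: ker_class)
    then have "\<alpha> (g y) i = \<alpha> y i" for y
      using covering_endo_agree[OF Aut_endo[OF g(1)] covering_endo_id i] by blast
    then have "g \<in> N" using g(1) by (simp add: N action_kernel_ker)
    then show "C = N" using G.coset_join2[OF g(1) sub] g(2) by simp
  qed
  ultimately show ?thesis
    unfolding residually_free_def
    by (intro exI[of _ "ker ` I"]) (auto simp: invariant_ker FactGroup_def Let_def)
qed

section \<open>The action topology\<close>

abbreviation T :: "('a \<Rightarrow> 'a) topology" where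
  "T \<equiv> action_topology G \<Gamma> (\<lambda>h. h)"

text \<open>For \<open>g\<close> in the group and \<open>i\<close> in the index set, this is the
  left coset of the kernel of the action at level \<open>i\<close> that contains \<open>g\<close>,
  written in coordinates.\<close>

definition cell :: "'i \<Rightarrow> ('a \<Rightarrow> 'a) \<Rightarrow> ('a \<Rightarrow> 'a) set" where
  "cell i g = {h \<in> carrier G. \<forall>x. \<alpha> (h x) i = \<alpha> (g x) i}"

lemma cell_self: "g \<in> carrier G \<Longrightarrow> g \<in> cell i g"
  by (simp add: cell_def)

text \<open>By rigidity, agreement at one point puts \<open>h\<close> in the cell.\<close>

lemma cellI:
  assumes "g \<in> carrier G" "h \<in> carrier G" "i \<in> I" "\<alpha> (h x) i = \<alpha> (g x) i"
  shows "h \<in> cell i g"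
  using covering_endo_agree[OF Aut_endo Aut_endo] assms unfolding cell_def by blast

text \<open>The kernels at the levels are invariant entourages and every entourage contains one, so
  cells may replace the cosets of arbitrary action kernels.\<close>

lemma openin_T: "openin T U \<longleftrightarrow> U \<subseteq> carrier G \<and> (\<forall>g\<in>U. \<exists>i\<in>I. cell i g \<subseteq> U)"
proof -
  have "(\<exists>R. invariant_entourage G \<Gamma> (\<lambda>h. h) R \<and> g <#\<^bsub>G\<^esub> action_kernel G \<Gamma> (\<lambda>h. h) R \<subseteq> U)
      \<longleftrightarrow> (\<exists>i\<in>I. cell i g \<subseteq> U)" if g: "g \<in> carrier G" for g
  proof
    assume "\<exists>R. invariant_entourage G \<Gamma> (\<lambda>h. h) R \<and> g <#\<^bsub>G\<^esub> action_kernel G \<Gamma> (\<lambda>h. h) R \<subseteq> U"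
    then obtain R where R: "entourage R" "g <#\<^bsub>G\<^esub> action_kernel G \<Gamma> (\<lambda>h. h) R \<subseteq> U"
      by (auto simp: invariant_entourage_def compatible_cofinite_entourage_def)
    obtain i where i: "i \<in> I" "ker i \<subseteq> R" using entourage_contains_ker[OF R(1)] by blast
    have "h \<in> U" if h: "h \<in> cell i g" for h
    proof -
      have hG: "h \<in> carrier G" and hx: "\<alpha> (h x) i = \<alpha> (g x) i" for x
        using h by (auto simp: cell_def)
      \<comment> \<open>Cancelling \<open>g\<close> by \<open>Aut_ker\<close> shows that
        \<open>?n\<close> acts trivially modulo level \<open>i\<close>, and \<open>h\<close> is
        \<open>g\<close> times \<open>?n\<close>.\<close>
      let ?n = "inv\<^bsub>G\<^esub> g \<otimes>\<^bsub>G\<^esub> h"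
      have n: "?n \<in> carrier G" using g hG by simp
      have "\<alpha> (?n x) i = \<alpha> x i" for x
        using Aut_ker[OF g i(1), of "?n x" x] hx Aut_inv[OF g] by (simp add: Aut_mult)
      then have "?n \<in> action_kernel G \<Gamma> (\<lambda>h. h) R"
        using n i(2) by (auto simp: action_kernel_def ker_def)
      moreover have "h = g \<otimes>\<^bsub>G\<^esub> ?n" using g hG by (simp add: G.m_assoc[symmetric])
      ultimately show ?thesis using R(2) unfolding l_coset_def by blast
    qed
    then show "\<exists>i\<in>I. cell i g \<subseteq> U" using i(1) by blast
  next
    assume "\<exists>i\<in>I. cell i g \<subseteq> U"
    then obtain i where i: "i \<in> I" "cell i g \<subseteq> U" by blast
    have "g <#\<^bsub>G\<^esub> action_kernel G \<Gamma> (\<lambda>h. h) (ker i) \<subseteq> cell i g"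
      using Aut_ker[OF g i(1)] G.m_closed[OF g]
      by (auto simp: l_coset_def action_kernel_ker cell_def Aut_mult)
    then show "\<exists>R. invariant_entourage G \<Gamma> (\<lambda>h. h) R \<and> g <#\<^bsub>G\<^esub> action_kernel G \<Gamma> (\<lambda>h. h) R \<subseteq> U"
      using invariant_ker[OF i(1)] i(2) by blast
  qed
  then show ?thesis
    unfolding openin_action_topology[OF graph_action_Aut] by blast
qed

lemma openin_cell: "i \<in> I \<Longrightarrow> openin T (cell i g)"
  unfolding openin_T by (intro conjI ballI bexI[of _ i]) (auto simp: cell_def)

lemma topspace_T: "topspace T = carrier G"
proof
  show "topspace T \<subseteq> carrier G" using openin_T[of "topspace T"] by simp
  have "openin T (carrier G)"
    unfolding openin_T using directed unfolding directed_index_def cell_def by blast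
  then show "carrier G \<subseteq> topspace T" by (rule openin_subset)
qed

lemma continuous_mult: "continuous_map (prod_topology T T) T (\<lambda>(g, h). g \<otimes>\<^bsub>G\<^esub> h)"
  unfolding continuous_map_def
proof (intro conjI allI impI)
  show "(\<lambda>(g, h). g \<otimes>\<^bsub>G\<^esub> h) \<in> topspace (prod_topology T T) \<rightarrow> topspace T"
    by (auto simp: topspace_T)
  fix U assume U: "openin T U"
  show "openin (prod_topology T T) {p \<in> topspace (prod_topology T T). (case p of (g, h) \<Rightarrow> g \<otimes>\<^bsub>G\<^esub> h) \<in> U}"
    unfolding openin_prod_topology_alt
  proof (intro allI impI)
    fix g h assume "(g, h) \<in> {p \<in> topspace (prod_topology T T). (case p of (g, h) \<Rightarrow> g \<otimes>\<^bsub>G\<^esub> h) \<in> U}"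
    then have gh: "g \<in> carrier G" "h \<in> carrier G" "g \<otimes>\<^bsub>G\<^esub> h \<in> U" by (auto simp: topspace_T)
    then obtain i where i: "i \<in> I" "cell i (g \<otimes>\<^bsub>G\<^esub> h) \<subseteq> U" using U openin_T by blast
    have "g' \<otimes>\<^bsub>G\<^esub> h' \<in> U" if "g' \<in> cell i g" "h' \<in> cell i h" for g' h'
    proof -
      have *: "g' \<in> carrier G" "h' \<in> carrier G" "\<alpha> (g' x) i = \<alpha> (g x) i" "\<alpha> (h' x) i = \<alpha> (h x) i" for x
        using that by (auto simp: cell_def)
      \<comment> \<open>The comparison passes through \<open>g (h' x)\<close>: first
        \<open>g'\<close> is replaced by \<open>g\<close>, then \<open>h'\<close> by
        \<open>h\<close> under the level-preserving \<open>g\<close>.\<close>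
      have "\<alpha> (g' (h' x)) i = \<alpha> (g (h x)) i" for x
        using *(3)[of "h' x"] *(4)[of x] Aut_ker[OF gh(1) i(1)] by simp
      then have "g' \<otimes>\<^bsub>G\<^esub> h' \<in> cell i (g \<otimes>\<^bsub>G\<^esub> h)"
        using G.m_closed[OF *(1,2)] by (simp add: cell_def Aut_mult)
      then show ?thesis using i(2) by blast
    qed
    moreover have "cell i g \<subseteq> carrier G" "cell i h \<subseteq> carrier G" by (auto simp: cell_def)
    ultimately show "\<exists>V W. openin T V \<and> openin T W \<and> g \<in> V \<and> h \<in> W \<and>
        V \<times> W \<subseteq> {p \<in> topspace (prod_topology T T). (case p of (g, h) \<Rightarrow> g \<otimes>\<^bsub>G\<^esub> h) \<in> U}"
      using openin_cell[OF i(1)] gh cell_self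
      by (intro exI[of _ "cell i g"] exI[of _ "cell i h"]) (auto simp: topspace_T)
  qed
qed

lemma continuous_inv: "continuous_map T T (\<lambda>g. inv\<^bsub>G\<^esub> g)"
  unfolding continuous_map_def
proof (intro conjI allI impI)
  show "(\<lambda>g. inv\<^bsub>G\<^esub> g) \<in> topspace T \<rightarrow> topspace T" by (auto simp: topspace_T)
  fix U assume U: "openin T U"
  have "\<exists>i\<in>I. cell i g \<subseteq> {g \<in> topspace T. inv\<^bsub>G\<^esub> g \<in> U}"
    if g: "g \<in> carrier G" "inv\<^bsub>G\<^esub> g \<in> U" for g
  proof -
    obtain i where i: "i \<in> I" "cell i (inv\<^bsub>G\<^esub> g) \<subseteq> U" using U g openin_T by blast
    have "inv\<^bsub>G\<^esub> h \<in> cell i (inv\<^bsub>G\<^esub> g)" if h: "h \<in> cell i g" for h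
    proof -
      have hG: "h \<in> carrier G" and hx: "\<alpha> (h x) i = \<alpha> (g x) i" for x using h by (auto simp: cell_def)
      \<comment> \<open>Both sides equal \<open>\<alpha> x i\<close>; \<open>Aut_ker\<close> then
        cancels \<open>h\<close>.\<close>
      have "\<alpha> (h ((inv\<^bsub>G\<^esub> h) x)) i = \<alpha> (h ((inv\<^bsub>G\<^esub> g) x)) i" for x
        using hx[of "(inv\<^bsub>G\<^esub> g) x"] Aut_inv[OF hG] Aut_inv[OF g(1)] by simp
      then show ?thesis using Aut_ker[OF hG i(1)] G.inv_closed[OF hG] by (simp add: cell_def)
    qed
    then show ?thesis using i by (intro bexI[of _ i]) (auto simp: topspace_T cell_def)
  qed
  then show "openin T {g \<in> topspace T. inv\<^bsub>G\<^esub> g \<in> U}"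
    unfolding openin_T by (auto simp: topspace_T)
qed

text \<open>At level \<open>i\<close> the value \<open>h y\<close> depends only on the cell of
  \<open>h\<close> and the fibre of \<open>y\<close>, so their product is the required
  neighbourhood.\<close>

lemma continuous_action: "continuous_map (prod_topology T euclidean) euclidean (\<lambda>(h, x). h x)"
  unfolding continuous_map_def
proof (intro conjI allI impI)
  fix U :: "'a set" assume "openin euclidean U"
  then have U: "open U" by simp
  show "openin (prod_topology T euclidean) {p \<in> topspace (prod_topology T euclidean). (case p of (h, x) \<Rightarrow> h x) \<in> U}"
    unfolding openin_prod_topology_alt
  proof (intro allI impI)
    fix g x assume "(g, x) \<in> {p \<in> topspace (prod_topology T euclidean). (case p of (h, x) \<Rightarrow> h x) \<in> U}"
    then have g: "g \<in> carrier G" "g x \<in> U" by (auto simp: topspace_T)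
    obtain i where i: "i \<in> I" "{y. \<alpha> y i = \<alpha> (g x) i} \<subseteq> U" using alpha_basis[OF U g(2)] by blast
    have "h y \<in> U" if "h \<in> cell i g" "\<alpha> y i = \<alpha> x i" for h y
    proof -
      have "\<alpha> (h y) i = \<alpha> (g x) i" using that Aut_ker[OF g(1) i(1)] by (simp add: cell_def)
      then show ?thesis using i(2) by blast
    qed
    moreover have "cell i g \<subseteq> carrier G" by (auto simp: cell_def)
    ultimately show "\<exists>V W. openin T V \<and> openin euclidean W \<and> g \<in> V \<and> x \<in> W \<and>
        V \<times> W \<subseteq> {p \<in> topspace (prod_topology T euclidean). (case p of (h, x) \<Rightarrow> h x) \<in> U}"
      using openin_cell[OF i(1)] g cell_self open_alpha_fibre[OF i(1)]
      by (intro exI[of _ "cell i g"] exI[of _ "{y. \<alpha> y i = \<alpha> x i}"]) (auto simp: topspace_T)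
  qed
qed simp

text \<open>
  \<open>G\<close> inherits compactness and total disconnectedness from a vertex fibre, to which the orbit map
  is a homeomorphism.
\<close>

lemma orbit_map_homeomorphic:
  assumes x: "x \<in> verts \<Gamma>"
  shows "homeomorphic_map T (top_of_set (f -` {f x})) (\<lambda>g. g x)"
proof (rule bijective_open_imp_homeomorphic_map)
  have fx: "f (g x) = f x" if "g \<in> carrier G" for g
    using Aut_endo[OF that] by (simp add: covering_endo_def)
  have "openin T {g \<in> topspace T. g x \<in> U}" if U: "open U" for U
    unfolding openin_T
  proof (intro conjI ballI)
    fix g assume "g \<in> {g \<in> topspace T. g x \<in> U}"
    then obtain i where "i \<in> I" "{y. \<alpha> y i = \<alpha> (g x) i} \<subseteq> U"
      using alpha_basis[OF U] by blast
    then show "\<exists>i\<in>I. cell i g \<subseteq> {g \<in> topspace T. g x \<in> U}"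
      by (intro bexI[of _ i]) (auto simp: topspace_T cell_def)
  qed (auto simp: topspace_T)
  then have "continuous_map T euclidean (\<lambda>g. g x)" by (auto simp: continuous_map_def)
  then show "continuous_map T (top_of_set (f -` {f x})) (\<lambda>g. g x)"
    using fx by (auto simp: continuous_map_in_subtopology topspace_T)
  show "open_map T (top_of_set (f -` {f x})) (\<lambda>g. g x)"
    unfolding open_map_def
  proof (intro allI impI)
    fix U assume U: "openin T U"
    have "\<exists>W. openin (top_of_set (f -` {f x})) W \<and> y \<in> W \<and> W \<subseteq> (\<lambda>g. g x) ` U"
      if y: "y \<in> (\<lambda>g. g x) ` U" for y
    proof -
      obtain g where g: "g \<in> U" "y = g x" using y by blast
      obtain i where i: "i \<in> I" "cell i g \<subseteq> U" using U g openin_T by blast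
      have gG: "g \<in> carrier G" using U g openin_T by blast
      let ?W = "f -` {f x} \<inter> {z. \<alpha> z i = \<alpha> y i}"
      have "z \<in> (\<lambda>g. g x) ` U" if z: "z \<in> ?W" for z
      proof -
        have "z \<in> verts \<Gamma>"
          using z graph_map_verts[OF f_map x] graph_map_vert_iff[OF target.graph_\<Gamma> f_map, of z] points_\<Gamma>
          by simp
        \<comment> \<open>Transitivity lifts a nearby point \<open>z\<close> of the fibre to
          \<open>h\<close>; agreement with \<open>g\<close> at the single vertex \<open>x\<close>
          puts \<open>h\<close> in the cell, which makes the orbit map open.\<close>
        then obtain h where h: "h \<in> carrier G" "h x = z" using Aut_transitive[OF x, of z] z by auto
        then have "h \<in> U" using cellI[OF gG h(1) i(1), of x] z g(2) i(2) by blast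
        then show ?thesis using h(2) by blast
      qed
      moreover have "openin (top_of_set (f -` {f x})) ?W"
        using open_alpha_fibre[OF i(1)] by (auto simp: openin_open)
      moreover have "y \<in> ?W" using fx[OF gG] g(2) by simp
      ultimately show ?thesis by blast
    qed
    then show "openin (top_of_set (f -` {f x})) ((\<lambda>g. g x) ` U)"
      by (subst openin_subopen) blast
  qed
  show "(\<lambda>g. g x) ` topspace T = topspace (top_of_set (f -` {f x}))"
  proof (intro equalityI subsetI)
    fix z assume z: "z \<in> topspace (top_of_set (f -` {f x}))"
    then have "z \<in> verts \<Gamma>"
      using graph_map_verts[OF f_map x] graph_map_vert_iff[OF target.graph_\<Gamma> f_map, of z] points_\<Gamma>
      by simp
    then show "z \<in> (\<lambda>g. g x) ` topspace T"
      using Aut_transitive[OF x, of z] z by (auto simp: topspace_T)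
  qed (use fx in \<open>auto simp: topspace_T\<close>)
  show "inj_on (\<lambda>g. g x) (topspace T)"
    unfolding topspace_T
    by (intro inj_onI ext) (rule covering_endo_eqI[OF Aut_endo Aut_endo])
qed

lemma profinite_group_Aut: "profinite_group G T"
proof -
  obtain x where x: "x \<in> verts \<Gamma>" using ex_vertex by blast
  note hom = orbit_map_homeomorphic[OF x]
  have hs: "T homeomorphic_space top_of_set (f -` {f x})"
    using hom by (rule homeomorphic_map_imp_homeomorphic_space)
  have "closed (f -` {f x})" using closed_vimage[OF closed_singleton f_continuous] .
  then have "compact (f -` {f x})" using compact_\<Gamma> compact_Int_closed[of UNIV] by simp
  then have "compact_space (top_of_set (f -` {f x}))"
    by (simp add: compact_space_subtopology)
  then have "compact_space T" using homeomorphic_compact_space[OF hs] by simp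
  moreover have "Hausdorff_space (euclidean :: 'a topology)"
    by (metis Hausdorff_space_def disjnt_def hausdorff open_openin)
  then have "Hausdorff_space T"
    unfolding homeomorphic_Hausdorff_space[OF hs] by (rule Hausdorff_space_subtopology)
  moreover have "\<exists>g. C \<subseteq> {g}" if C: "connectedin T C" for C
  proof -
    have CG: "C \<subseteq> carrier G" using C connectedin_subset_topspace topspace_T by blast
    have "connectedin (top_of_set (f -` {f x})) ((\<lambda>g. g x) ` C)"
      using connectedin_continuous_map_image[OF homeomorphic_imp_continuous_map[OF hom] C] .
    then have conn: "connected ((\<lambda>g. g x) ` C)" by (simp add: connectedin_subtopology)
    have "g = h" if gh: "g \<in> C" "h \<in> C" for g h
    proof -
      have "\<alpha> (g x) i = \<alpha> (h x) i" if i: "i \<in> I" for i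
      proof (rule ccontr)
        assume n: "\<alpha> (g x) i \<noteq> \<alpha> (h x) i"
        \<comment> \<open>The level-\<open>i\<close> fibre through \<open>g x\<close> is clopen and
          would separate \<open>g x\<close> from \<open>h x\<close> inside a connected set.\<close>
        let ?A = "{y. \<alpha> y i = \<alpha> (g x) i}"
        have "- ?A = (\<Union>z\<in>- {\<alpha> (g x) i}. {y. \<alpha> y i = z})" by auto
        then have "open ?A" "open (- ?A)" using open_alpha_fibre[OF i] by auto
        moreover have "g x \<in> ?A \<inter> (\<lambda>g. g x) ` C" "h x \<in> - ?A \<inter> (\<lambda>g. g x) ` C"
          using gh n by auto
        ultimately show False using connectedD[OF conn, of ?A "- ?A"] by blast
      qed
      then have "g x = h x" by (rule alpha_eqI)
      then show ?thesis
        using covering_endo_eqI[OF Aut_endo Aut_endo, of g h x] gh CG by (intro ext) blast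
    qed
    then show ?thesis by blast
  qed
  ultimately show ?thesis
    using group_Aut topspace_T continuous_mult continuous_inv by (simp add: profinite_group_def)
qed

end

theorem theorem16:
  fixes \<Gamma> :: "'a::{t2_space,uniform_space} pre_graph"
    and \<Delta> :: "'b::{t2_space,uniform_space} pre_graph"
    and f :: "'a \<Rightarrow> 'b"
    and G :: "('a \<Rightarrow> 'a) monoid"
  assumes "G = Aut \<Gamma> f"
    and "regular_covering TYPE('i \<times> 'c \<times> 'd) \<Gamma> \<Delta> f"
  shows "profinite_group G (action_topology G \<Gamma> (\<lambda>h. h)) \<and>
         graph_action G \<Gamma> (\<lambda>h. h) \<and>
         continuous_map (prod_topology (action_topology G \<Gamma> (\<lambda>h. h)) euclidean) euclidean
           (\<lambda>(h, x). h x) \<and>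
         residually_free G \<Gamma> (\<lambda>h. h) \<and>
         (\<forall>b\<in>verts \<Delta>. simply_transitive_on G (\<lambda>h. h) (f -` {b}))"
proof -
  obtain I :: "'i set" and below and X :: "'i \<Rightarrow> 'c pre_graph" and \<phi> and Y :: "'i \<Rightarrow> 'd pre_graph"
    and \<psi> q \<alpha> \<beta> where
    pf: "profinite_graph \<Gamma>" "profinite_graph \<Delta>" and f: "graph_map \<Gamma> \<Delta> f" "continuous_on UNIV f" and
    sys: "directed_index I below" "graph_inverse_system I below X \<phi>" "graph_inverse_system I below Y \<psi>" and
    cov: "\<forall>i\<in>I. finite_regular_covering (X i) (Y i) (q i)" and
    comm: "\<forall>i\<in>I. \<forall>j\<in>I. below i j \<longrightarrow> (\<forall>x\<in>points (X j). q i (\<phi> i j x) = \<psi> i j (q j x))" and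
    lim: "limit_iso I below X \<phi> \<Gamma> \<alpha>" "limit_iso I below Y \<psi> \<Delta> \<beta>" and
    \<beta>: "\<forall>x\<in>points \<Gamma>. \<beta> (f x) = (\<lambda>i\<in>I. q i (\<alpha> x i))"
    using assms(2) unfolding regular_covering_def by (elim conjE exE)
  have g: "is_graph \<Gamma>" "points \<Gamma> = UNIV" "is_graph \<Delta>" "points \<Delta> = UNIV"
    using pf by (auto simp: profinite_graph_def cofinite_graph_def)
  interpret regular_covering_limit I below X \<phi> \<Gamma> \<alpha> Y \<psi> \<Delta> \<beta> q f
  proof (intro regular_covering_limit.intro graph_limit.intro regular_covering_limit_axioms.intro)
    show "regular_covering_map (X i) (Y i) (q i)" if "i \<in> I" for i
      using finite_regular_covering_imp_regular_covering_map cov that by blast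
  qed (use pf f sys cov comm lim \<beta> g in \<open>auto simp: finite_regular_covering_def\<close>)
  show ?thesis
    unfolding assms(1)
    using profinite_group_Aut graph_action_Aut continuous_action residually_free_Aut
      Aut_simply_transitive by blast
qed

end
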